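(* Let $(\mathcal C,\otimes,\mathbf I)$ be a preadditive strict monoidal category and $(V,\sigma)$ a pre-braided object in $\mathcal C$ endowed with braided characters $\epsilon$ and $\zeta$. (1) The morphisms $({}^{\epsilon}d)_n:=\epsilon_1\circ\mathrm{csh}_{-\sigma}^{1,n-1}$ and $(d^{\zeta})_n:=(-1)^{n-1}\zeta_n\circ\mathrm{csh}_{-\sigma}^{n-1,1}$ ($n\ge1$) define a bidegree $-1$ tensor bidifferential for $V$. (2) This bidifferential can be refined into a pre-bisimplicial structure on $(V^{\otimes n})_{n\ge 0}$ given by $d_{n;i}:=\epsilon_1\circ T^{\sigma}_{p_{i,n}}$, $d'_{n;i}:=\zeta_n\circ T^{\sigma}_{p'_{i,n}}$, $1\le i\le n$ (i.e. $({}^{\epsilon}d)_n=\sum_i(-1)^{i-1}d_{n;i}$ and $(d^{\zeta})_n=\sum_i(-1)^{i-1}d'_{n;i}$). (3) If a comultiplication $\Delta:V\to V\otimes V$ makes $(V,\sigma,\Delta)$ a pre-braided coalgebra, then the morphisms $s_{n;i}:=\Delta_i$ complete the structure of (2) into a very weakly bisimplicial one. (4) If $(V,\sigma,\Delta)$ is only a semi-pre-braided coalgebra, then $(V^{\otimes n},d_{n;i},s_{n;i})$ is a very weakly simplicial object. (5) If $\Delta$ is moreover $\sigma$-cocommutative, then the structures of (3) (resp. (4)) on $(V^{\otimes n})_{n\ge0}$ are weakly bisimplicial (resp. weakly simplicial). (6) Let $\eta:\mathbf I\to V$ be a morphism. The family $h_n:=(-1)^n\,\mathrm{Id}_{V^{\otimes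 n}}\otimes\eta:V^{\otimes n}\to V^{\otimes(n+1)}$ is a contracting homotopy for $(V^{\otimes n},({}^{\epsilon}d)_n)$ if the pair $(\eta,\epsilon)$ is normalized and $\sigma$ is demi-natural with respect to $\eta$; it is a contracting homotopy for $(V^{\otimes n},(d^{\zeta})_n)$ if the pair $(\eta,\zeta)$ is normalized and right $\sigma$-compatible.
   Context: In a preadditive monoidal category, $\otimes$ is additive in each variable. $V^{\otimes 0}=\mathbf I$. For $\varphi:V^{\otimes l}\to V^{\otimes r}$, $\varphi_i=\mathrm{Id}_{V^{\otimes(i-1)}}\otimes\varphi\otimes\mathrm{Id}$. A pre-braided object is an object $V$ with a morphism $\sigma:V\otimes V\to V\otimes V$ (a pre-braiding, not necessarily invertible) such that $\sigma_1\sigma_2\sigma_1=\sigma_2\sigma_1\sigma_2$ on $V^{\otimes3}$; then $-\sigma$ is a pre-braiding too. A braided character is $\epsilon:V\to\mathbf I$ with $(\epsilon\otimes\epsilon)\circ\sigma=\epsilon\otimes\epsilon$. For a pre-braiding $\beta$ and $s\in S_n$ with shortest expression $s=\tau_{i_1}\cdots\tau_{i_k}$ in adjacent transpositions, $T_s^{\beta}=\beta_{i_1}\circ\cdots\circ\beta_{i_k}$ on $V^{\otimes n}$. With $Sh_{p,q}=\{s\in S_{p+q}: s(1)<\dots<s(p),\ s(p+1)<\dots<s(p+q)\}$, $\mathrm{csh}_{\beta}^{p,q}=\sum_{s\in Sh_{p,q}}T^{\beta}_{s^{-1}}:V^{\otimes(p+q)}\to V^{\otimes p}\otimes V^{\otimes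 q}$. The permutation $p_{i,n}$ (resp. $p'_{i,n}$) moves the $i$-th element to the leftmost (resp. rightmost) position, keeping the order of the others; so $T^{\sigma}_{p_{i,n}}=\sigma_1\circ\cdots\circ\sigma_{i-1}$, $T^{\sigma}_{p'_{i,n}}=\sigma_{n-1}\circ\cdots\circ\sigma_i$. A bidegree $-1$ tensor bidifferential for $V$ is a pair of families $d_n,d'_n:V^{\otimes n}\to V^{\otimes(n-1)}$ ($n>0$) with $d_{n-1}d_n=d'_{n-1}d'_n=d'_{n-1}d_n+d_{n-1}d'_n=0$ for $n>1$. A contracting homotopy for a degree $-1$ differential $(V_n,d_n)$ is a family $h_n:V_n\to V_{n+1}$ ($n\ge0$) with $h_{n-1}d_n+d_{n+1}h_n=\mathrm{Id}_{V_n}$ for all $n>0$. $(V,\sigma,\Delta)$ is a pre-braided coalgebra if $\Delta$ is coassociative, $\Delta_2\sigma=\sigma_1\sigma_2\Delta_1$ and $\Delta_1\sigma=\sigma_2\sigma_1\Delta_2$; semi-pre-braided if $\Delta$ is coassociative and only the first of these identities is required; $\sigma$-cocommutative if $\sigma\Delta=\Delta$. For $\eta:\mathbf I\to V$, $\psi:V\to\mathbf I$: the pair $(\eta,\psi)$ is normalized if $\psi\circ\eta=\mathrm{Id}_{\mathbf I}$, and right $\sigma$-compatible if $(\mathrm{Id}_V\otimes\psi)\circ\sigma\circ(\mathrm{Id}_V\otimes\eta)=\eta\circ\psi$. $\sigma$ is demi-natural with respect to $\eta$ if $\sigma\circ(\mathrm{Id}_V\otimes\eta)=\eta\otimes\mathrm{Id}_V$.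 Simplicial vocabulary, for objects $V_n$ ($n\ge0$) with morphisms $d_{n;i},d'_{n;i}:V_n\to V_{n-1}$, $s_{n;i}:V_n\to V_{n+1}$, $1\le i\le n$ (first subscripts omitted, composites having source $V_n$): presimplicial: $d_id_j=d_{j-1}d_i$ for $1\le i<j\le n$; very weakly simplicial: moreover $s_is_j=s_{j+1}s_i$ for $1\le i\le j\le n$, $d_is_j=s_{j-1}d_i$ for $1\le i<j\le n$, $d_is_j=s_jd_{i-1}$ for $1\le j$, $j+1<i\le n+1$; weakly simplicial: moreover $d_is_i=d_{i+1}s_i$ for $1\le i\le n$; pre-bisimplicial: $(V_n,d)$ and $(V_n,d')$ presimplicial and $d_id'_j=d'_{j-1}d_i$, $d'_id_j=d_{j-1}d'_i$ for $1\le i<j\le n$; (very) weakly bisimplicial: pre-bisimplicial with both $(V_n,d,s)$ and $(V_n,d',s)$ (very) weakly simplicial. *)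

theory Defs
  imports "HOL-Algebra.FiniteProduct" "HOL-Combinatorics.Permutations"
begin

section \<open>Preadditive strict monoidal categories\<close>

text \<open>
  A category is given by its objects and arrows with domain and codomain maps, so that hom-sets of
  different pairs of objects are disjoint. \<open>g \<cdot> f\<close> means first \<open>f\<close>, then \<open>g\<close>. All laws are only
  required on the carriers.
\<close>

record ('o, 'm) moncat =
  Obj :: "'o set"
  Arr :: "'m set"
  dom :: "'m \<Rightarrow> 'o"
  cod :: "'m \<Rightarrow> 'o"
  Id :: "'o \<Rightarrow> 'm"
  comp :: "'m \<Rightarrow> 'm \<Rightarrow> 'm"  (infixr "\<cdot>\<index>" 70)
  unit_obj :: "'o"
  tens_obj :: "'o \<Rightarrow> 'o \<Rightarrow> 'o"  (infixr "\<otimes>\<^sub>o\<index>" 75)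
  tens_mor :: "'m \<Rightarrow> 'm \<Rightarrow> 'm"  (infixr "\<otimes>\<^sub>m\<index>" 75)
  madd :: "'m \<Rightarrow> 'm \<Rightarrow> 'm"  (infixl "+\<^sub>m\<index>" 65)
  mzero :: "'o \<Rightarrow> 'o \<Rightarrow> 'm"

definition Hom :: "('o, 'm, 'x) moncat_scheme \<Rightarrow> 'o \<Rightarrow> 'o \<Rightarrow> 'm set" where
  "Hom C A B = {f \<in> Arr C. dom C f = A \<and> cod C f = B}"

text \<open>
  The group structure on a hom-set as a group record. The group operation is addition of
  morphisms, so \<open>finprod\<close> over this group is a sum of morphisms, \<open>m_inv\<close> is negation, and
  a power with integer exponent is an integer multiple.
\<close>

definition hom_group :: "('o, 'm, 'x) moncat_scheme \<Rightarrow> 'o \<Rightarrow> 'o \<Rightarrow> 'm monoid" where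
  "hom_group C A B = \<lparr>carrier = Hom C A B, monoid.mult = madd C, one = mzero C A B\<rparr>"

locale category =
  fixes C :: "('o, 'm, 'x) moncat_scheme" (structure)
  assumes dom_Obj: "f \<in> Arr C \<Longrightarrow> dom C f \<in> Obj C"
    and cod_Obj: "f \<in> Arr C \<Longrightarrow> cod C f \<in> Obj C"
    and Id_hom: "A \<in> Obj C \<Longrightarrow> Id C A \<in> Hom C A A"
    and comp_hom: "\<lbrakk>f \<in> Hom C A B; g \<in> Hom C B D\<rbrakk> \<Longrightarrow> g \<cdot> f \<in> Hom C A D"
    and comp_Id_left: "f \<in> Hom C A B \<Longrightarrow> Id C B \<cdot> f = f"
    and comp_Id_right: "f \<in> Hom C A B \<Longrightarrow> f \<cdot> Id C A = f"
    and comp_assoc: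
      "\<lbrakk>f \<in> Hom C A B; g \<in> Hom C B D; h \<in> Hom C D E\<rbrakk> \<Longrightarrow> (h \<cdot> g) \<cdot> f = h \<cdot> (g \<cdot> f)"

locale strict_monoidal_category = category C for C :: "('o, 'm, 'x) moncat_scheme" (structure) +
  assumes unit_Obj: "unit_obj C \<in> Obj C"
    and tens_Obj: "\<lbrakk>A \<in> Obj C; B \<in> Obj C\<rbrakk> \<Longrightarrow> A \<otimes>\<^sub>o B \<in> Obj C"
    and tens_obj_assoc: "\<lbrakk>A \<in> Obj C; B \<in> Obj C; D \<in> Obj C\<rbrakk> \<Longrightarrow> (A \<otimes>\<^sub>o B) \<otimes>\<^sub>o D = A \<otimes>\<^sub>o (B \<otimes>\<^sub>o D)"
    and tens_obj_unit_left: "A \<in> Obj C \<Longrightarrow> unit_obj C \<otimes>\<^sub>o A = A"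
    and tens_obj_unit_right: "A \<in> Obj C \<Longrightarrow> A \<otimes>\<^sub>o unit_obj C = A"
    and tens_hom:
      "\<lbrakk>f \<in> Hom C A B; g \<in> Hom C A' B'\<rbrakk> \<Longrightarrow> f \<otimes>\<^sub>m g \<in> Hom C (A \<otimes>\<^sub>o A') (B \<otimes>\<^sub>o B')"
    and tens_mor_assoc:
      "\<lbrakk>f \<in> Arr C; g \<in> Arr C; h \<in> Arr C\<rbrakk> \<Longrightarrow> (f \<otimes>\<^sub>m g) \<otimes>\<^sub>m h = f \<otimes>\<^sub>m (g \<otimes>\<^sub>m h)"
    and tens_mor_unit_left: "f \<in> Arr C \<Longrightarrow> Id C (unit_obj C) \<otimes>\<^sub>m f = f"
    and tens_mor_unit_right: "f \<in> Arr C \<Longrightarrow> f \<otimes>\<^sub>m Id C (unit_obj C) = f"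
    and tens_Id: "\<lbrakk>A \<in> Obj C; B \<in> Obj C\<rbrakk> \<Longrightarrow> Id C A \<otimes>\<^sub>m Id C B = Id C (A \<otimes>\<^sub>o B)"
    and interchange:
      "\<lbrakk>f \<in> Hom C A B; g \<in> Hom C B D; f' \<in> Hom C A' B'; g' \<in> Hom C B' D'\<rbrakk>
        \<Longrightarrow> (g \<cdot> f) \<otimes>\<^sub>m (g' \<cdot> f') = (g \<otimes>\<^sub>m g') \<cdot> (f \<otimes>\<^sub>m f')"

locale preadditive_strict_monoidal_category = strict_monoidal_category C
  for C :: "('o, 'm, 'x) moncat_scheme" (structure) +
  assumes hom_comm_group: "\<lbrakk>A \<in> Obj C; B \<in> Obj C\<rbrakk> \<Longrightarrow> comm_group (hom_group C A B)"
    and comp_add_left: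
      "\<lbrakk>f \<in> Hom C A B; g \<in> Hom C B D; h \<in> Hom C B D\<rbrakk> \<Longrightarrow> (g +\<^sub>m h) \<cdot> f = (g \<cdot> f) +\<^sub>m (h \<cdot> f)"
    and comp_add_right:
      "\<lbrakk>f \<in> Hom C A B; g \<in> Hom C A B; h \<in> Hom C B D\<rbrakk> \<Longrightarrow> h \<cdot> (f +\<^sub>m g) = (h \<cdot> f) +\<^sub>m (h \<cdot> g)"
    and tens_add_left:
      "\<lbrakk>f \<in> Hom C A B; g \<in> Hom C A B; h \<in> Hom C A' B'\<rbrakk>
        \<Longrightarrow> (f +\<^sub>m g) \<otimes>\<^sub>m h = (f \<otimes>\<^sub>m h) +\<^sub>m (g \<otimes>\<^sub>m h)"
    and tens_add_right:
      "\<lbrakk>f \<in> Hom C A B; g \<in> Hom C A' B'; h \<in> Hom C A' B'\<rbrakk>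
        \<Longrightarrow> f \<otimes>\<^sub>m (g +\<^sub>m h) = (f \<otimes>\<^sub>m g) +\<^sub>m (f \<otimes>\<^sub>m h)"

definition msum :: "('o, 'm, 'x) moncat_scheme \<Rightarrow> 'o \<Rightarrow> 'o \<Rightarrow> ('a \<Rightarrow> 'm) \<Rightarrow> 'a set \<Rightarrow> 'm" where
  "msum C A B f S = finprod (hom_group C A B) f S"

definition mneg :: "('o, 'm, 'x) moncat_scheme \<Rightarrow> 'm \<Rightarrow> 'm" where
  "mneg C f = m_inv (hom_group C (dom C f) (cod C f)) f"

definition smul :: "('o, 'm, 'x) moncat_scheme \<Rightarrow> int \<Rightarrow> 'm \<Rightarrow> 'm" where
  "smul C k f = f [^]\<^bsub>hom_group C (dom C f) (cod C f)\<^esub> k"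

primrec tpow :: "('o, 'm, 'x) moncat_scheme \<Rightarrow> 'o \<Rightarrow> nat \<Rightarrow> 'o" where
  "tpow C V 0 = unit_obj C"
| "tpow C V (Suc n) = V \<otimes>\<^sub>o\<^bsub>C\<^esub> tpow C V n"

text \<open>
  \<open>ext C V l n i \<phi>\<close> is \<open>\<phi>\<^sub>i\<close> with source \<open>V^n\<close>, for a morphism \<open>\<phi> : V^l \<rightarrow> V^r\<close>; it is
  meaningful for \<open>1 \<le> i\<close> and \<open>i - 1 + l \<le> n\<close>.
\<close>

definition ext :: "('o, 'm, 'x) moncat_scheme \<Rightarrow> 'o \<Rightarrow> nat \<Rightarrow> nat \<Rightarrow> nat \<Rightarrow> 'm \<Rightarrow> 'm" where
  "ext C V l n i \<phi> =
     Id C (tpow C V (i - 1)) \<otimes>\<^sub>m\<^bsub>C\<^esub> \<phi> \<otimes>\<^sub>m\<^bsub>C\<^esub> Id C (tpow C V (n - (i - 1) - l))"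


section \<open>Pre-braided objects and quantum shuffles\<close>

definition prebraided_object :: "('o, 'm, 'x) moncat_scheme \<Rightarrow> 'o \<Rightarrow> 'm \<Rightarrow> bool" where
  "prebraided_object C V \<sigma> \<longleftrightarrow>
     V \<in> Obj C \<and> \<sigma> \<in> Hom C (V \<otimes>\<^sub>o\<^bsub>C\<^esub> V) (V \<otimes>\<^sub>o\<^bsub>C\<^esub> V) \<and>
     ext C V 2 3 1 \<sigma> \<cdot>\<^bsub>C\<^esub> ext C V 2 3 2 \<sigma> \<cdot>\<^bsub>C\<^esub> ext C V 2 3 1 \<sigma> =
     ext C V 2 3 2 \<sigma> \<cdot>\<^bsub>C\<^esub> ext C V 2 3 1 \<sigma> \<cdot>\<^bsub>C\<^esub> ext C V 2 3 2 \<sigma>"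

definition braided_character :: "('o, 'm, 'x) moncat_scheme \<Rightarrow> 'o \<Rightarrow> 'm \<Rightarrow> 'm \<Rightarrow> bool" where
  "braided_character C V \<sigma> \<epsilon> \<longleftrightarrow>
     \<epsilon> \<in> Hom C V (unit_obj C) \<and> (\<epsilon> \<otimes>\<^sub>m\<^bsub>C\<^esub> \<epsilon>) \<cdot>\<^bsub>C\<^esub> \<sigma> = \<epsilon> \<otimes>\<^sub>m\<^bsub>C\<^esub> \<epsilon>"

text \<open>
  The list \<open>[i\<^sub>1, \<dots>, i\<^sub>k]\<close> stands for the product of adjacent transpositions
  \<open>\<tau>\<^sub>i\<^sub>1 \<circ> \<dots> \<circ> \<tau>\<^sub>i\<^sub>k\<close>, where \<open>\<tau>\<^sub>i\<close> exchanges \<open>i\<close> and \<open>i + 1\<close>.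
\<close>

definition word_perm :: "nat list \<Rightarrow> nat \<Rightarrow> nat" where
  "word_perm w = foldr (\<lambda>i s. transpose i (Suc i) \<circ> s) w id"

definition shortest_word :: "nat \<Rightarrow> (nat \<Rightarrow> nat) \<Rightarrow> nat list \<Rightarrow> bool" where
  "shortest_word n s w \<longleftrightarrow>
     set w \<subseteq> {1..<n} \<and> word_perm w = s \<and>
     (\<forall>w'. set w' \<subseteq> {1..<n} \<and> word_perm w' = s \<longrightarrow> length w \<le> length w')"

text \<open>
  For a permutation \<open>s\<close> of \<open>{1..n}\<close> and a pre-braiding \<open>\<beta>\<close> the morphism \<open>T\<^sub>s\<^sup>\<beta>\<close> does not depend on
  the shortest word that is chosen: by Matsumoto's theorem any two of them are related by braid
  moves and by exchanges of commuting letters.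
\<close>

definition T_mor ::
  "('o, 'm, 'x) moncat_scheme \<Rightarrow> 'o \<Rightarrow> 'm \<Rightarrow> nat \<Rightarrow> (nat \<Rightarrow> nat) \<Rightarrow> 'm" where
  "T_mor C V \<beta> n s =
     foldr (\<lambda>i f. ext C V 2 n i \<beta> \<cdot>\<^bsub>C\<^esub> f) (SOME w. shortest_word n s w) (Id C (tpow C V n))"

definition Sh :: "nat \<Rightarrow> nat \<Rightarrow> (nat \<Rightarrow> nat) set" where
  "Sh p q = {s. s permutes {1..p+q} \<and> strict_mono_on {1..p} s \<and> strict_mono_on {p+1..p+q} s}"

definition csh :: "('o, 'm, 'x) moncat_scheme \<Rightarrow> 'o \<Rightarrow> 'm \<Rightarrow> nat \<Rightarrow> nat \<Rightarrow> 'm" where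
  "csh C V \<beta> p q =
     msum C (tpow C V (p+q)) (tpow C V (p+q)) (\<lambda>s. T_mor C V \<beta> (p+q) (inv_into UNIV s)) (Sh p q)"

text \<open>
  The permutations \<open>p\<^sub>i\<^sub>,\<^sub>n\<close> and \<open>p'\<^sub>i\<^sub>,\<^sub>n\<close>, as maps sending the old position of an element to its
  new position, for \<open>1 \<le> i \<le> n\<close>. The first one does not depend on \<open>n\<close>.
\<close>

definition move_left :: "nat \<Rightarrow> nat \<Rightarrow> nat" where
  "move_left i j = (if j = i then 1 else if 1 \<le> j \<and> j < i then j + 1 else j)"

definition move_right :: "nat \<Rightarrow> nat \<Rightarrow> nat \<Rightarrow> nat" where
  "move_right n i j = (if j = i then n else if i < j \<and> j \<le> n then j - 1 else j)"

definition left_d :: "('o, 'm, 'x) moncat_scheme \<Rightarrow> 'o \<Rightarrow> 'm \<Rightarrow> 'm \<Rightarrow> nat \<Rightarrow> 'm" where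
  "left_d C V \<sigma> \<epsilon> n = ext C V 1 n 1 \<epsilon> \<cdot>\<^bsub>C\<^esub> csh C V (mneg C \<sigma>) 1 (n - 1)"

definition right_d :: "('o, 'm, 'x) moncat_scheme \<Rightarrow> 'o \<Rightarrow> 'm \<Rightarrow> 'm \<Rightarrow> nat \<Rightarrow> 'm" where
  "right_d C V \<sigma> \<zeta> n =
     smul C ((-1) ^ (n - 1)) (ext C V 1 n n \<zeta> \<cdot>\<^bsub>C\<^esub> csh C V (mneg C \<sigma>) (n - 1) 1)"

definition left_face :: "('o, 'm, 'x) moncat_scheme \<Rightarrow> 'o \<Rightarrow> 'm \<Rightarrow> 'm \<Rightarrow> nat \<Rightarrow> nat \<Rightarrow> 'm" where
  "left_face C V \<sigma> \<epsilon> n i = ext C V 1 n 1 \<epsilon> \<cdot>\<^bsub>C\<^esub> T_mor C V \<sigma> n (move_left i)"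

definition right_face :: "('o, 'm, 'x) moncat_scheme \<Rightarrow> 'o \<Rightarrow> 'm \<Rightarrow> 'm \<Rightarrow> nat \<Rightarrow> nat \<Rightarrow> 'm" where
  "right_face C V \<sigma> \<zeta> n i = ext C V 1 n n \<zeta> \<cdot>\<^bsub>C\<^esub> T_mor C V \<sigma> n (move_right n i)"


section \<open>Coalgebras and compatibility conditions\<close>

definition coassociative :: "('o, 'm, 'x) moncat_scheme \<Rightarrow> 'o \<Rightarrow> 'm \<Rightarrow> bool" where
  "coassociative C V \<Delta> \<longleftrightarrow>
     \<Delta> \<in> Hom C V (V \<otimes>\<^sub>o\<^bsub>C\<^esub> V) \<and>
     (\<Delta> \<otimes>\<^sub>m\<^bsub>C\<^esub> Id C V) \<cdot>\<^bsub>C\<^esub> \<Delta> = (Id C V \<otimes>\<^sub>m\<^bsub>C\<^esub> \<Delta>) \<cdot>\<^bsub>C\<^esub> \<Delta>"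

definition semi_prebraided_coalgebra ::
  "('o, 'm, 'x) moncat_scheme \<Rightarrow> 'o \<Rightarrow> 'm \<Rightarrow> 'm \<Rightarrow> bool" where
  "semi_prebraided_coalgebra C V \<sigma> \<Delta> \<longleftrightarrow>
     prebraided_object C V \<sigma> \<and> coassociative C V \<Delta> \<and>
     ext C V 1 2 2 \<Delta> \<cdot>\<^bsub>C\<^esub> \<sigma> = ext C V 2 3 1 \<sigma> \<cdot>\<^bsub>C\<^esub> ext C V 2 3 2 \<sigma> \<cdot>\<^bsub>C\<^esub> ext C V 1 2 1 \<Delta>"

definition prebraided_coalgebra ::
  "('o, 'm, 'x) moncat_scheme \<Rightarrow> 'o \<Rightarrow> 'm \<Rightarrow> 'm \<Rightarrow> bool" where
  "prebraided_coalgebra C V \<sigma> \<Delta> \<longleftrightarrow>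
     semi_prebraided_coalgebra C V \<sigma> \<Delta> \<and>
     ext C V 1 2 1 \<Delta> \<cdot>\<^bsub>C\<^esub> \<sigma> = ext C V 2 3 2 \<sigma> \<cdot>\<^bsub>C\<^esub> ext C V 2 3 1 \<sigma> \<cdot>\<^bsub>C\<^esub> ext C V 1 2 2 \<Delta>"

definition cocommutative :: "('o, 'm, 'x) moncat_scheme \<Rightarrow> 'm \<Rightarrow> 'm \<Rightarrow> bool" where
  "cocommutative C \<sigma> \<Delta> \<longleftrightarrow> \<sigma> \<cdot>\<^bsub>C\<^esub> \<Delta> = \<Delta>"

definition normalized_pair :: "('o, 'm, 'x) moncat_scheme \<Rightarrow> 'm \<Rightarrow> 'm \<Rightarrow> bool" where
  "normalized_pair C \<eta> \<psi> \<longleftrightarrow> \<psi> \<cdot>\<^bsub>C\<^esub> \<eta> = Id C (unit_obj C)"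

definition right_compatible ::
  "('o, 'm, 'x) moncat_scheme \<Rightarrow> 'o \<Rightarrow> 'm \<Rightarrow> 'm \<Rightarrow> 'm \<Rightarrow> bool" where
  "right_compatible C V \<sigma> \<eta> \<psi> \<longleftrightarrow>
     (Id C V \<otimes>\<^sub>m\<^bsub>C\<^esub> \<psi>) \<cdot>\<^bsub>C\<^esub> \<sigma> \<cdot>\<^bsub>C\<^esub> (Id C V \<otimes>\<^sub>m\<^bsub>C\<^esub> \<eta>) = \<eta> \<cdot>\<^bsub>C\<^esub> \<psi>"

definition demi_natural :: "('o, 'm, 'x) moncat_scheme \<Rightarrow> 'o \<Rightarrow> 'm \<Rightarrow> 'm \<Rightarrow> bool" where
  "demi_natural C V \<sigma> \<eta> \<longleftrightarrow> \<sigma> \<cdot>\<^bsub>C\<^esub> (Id C V \<otimes>\<^sub>m\<^bsub>C\<^esub> \<eta>) = \<eta> \<otimes>\<^sub>m\<^bsub>C\<^esub> Id C V"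


section \<open>Differentials and homotopies\<close>

definition differential ::
  "('o, 'm, 'x) moncat_scheme \<Rightarrow> (nat \<Rightarrow> 'o) \<Rightarrow> (nat \<Rightarrow> 'm) \<Rightarrow> bool" where
  "differential C X d \<longleftrightarrow>
     (\<forall>n>0. d n \<in> Hom C (X n) (X (n - 1))) \<and>
     (\<forall>n>1. d (n - 1) \<cdot>\<^bsub>C\<^esub> d n = mzero C (X n) (X (n - 2)))"

definition tensor_bidifferential ::
  "('o, 'm, 'x) moncat_scheme \<Rightarrow> 'o \<Rightarrow> (nat \<Rightarrow> 'm) \<Rightarrow> (nat \<Rightarrow> 'm) \<Rightarrow> bool" where
  "tensor_bidifferential C V d d' \<longleftrightarrow>
     differential C (tpow C V) d \<and> differential C (tpow C V) d' \<and>
     (\<forall>n>1. (d' (n - 1) \<cdot>\<^bsub>C\<^esub> d n) +\<^sub>m\<^bsub>C\<^esub> (d (n - 1) \<cdot>\<^bsub>C\<^esub> d' n) = mzero C (tpow C V n) (tpow C V (n - 2)))"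

definition contracting_homotopy ::
  "('o, 'm, 'x) moncat_scheme \<Rightarrow> (nat \<Rightarrow> 'o) \<Rightarrow> (nat \<Rightarrow> 'm) \<Rightarrow> (nat \<Rightarrow> 'm) \<Rightarrow> bool" where
  "contracting_homotopy C X d h \<longleftrightarrow>
     differential C X d \<and>
     (\<forall>n. h n \<in> Hom C (X n) (X (n + 1))) \<and>
     (\<forall>n>0. (h (n - 1) \<cdot>\<^bsub>C\<^esub> d n) +\<^sub>m\<^bsub>C\<^esub> (d (n + 1) \<cdot>\<^bsub>C\<^esub> h n) = Id C (X n))"


section \<open>Simplicial vocabulary\<close>

text \<open>
  \<open>d n i\<close> and \<open>s n i\<close> have source \<open>X n\<close> and are only relevant for \<open>1 \<le> i \<le> n\<close>.
\<close>

definition presimplicial ::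
  "('o, 'm, 'x) moncat_scheme \<Rightarrow> (nat \<Rightarrow> 'o) \<Rightarrow> (nat \<Rightarrow> nat \<Rightarrow> 'm) \<Rightarrow> bool" where
  "presimplicial C X d \<longleftrightarrow>
     (\<forall>n. X n \<in> Obj C) \<and>
     (\<forall>n i. 1 \<le> i \<and> i \<le> n \<longrightarrow> d n i \<in> Hom C (X n) (X (n - 1))) \<and>
     (\<forall>n i j. 1 \<le> i \<and> i < j \<and> j \<le> n \<longrightarrow>
        d (n - 1) i \<cdot>\<^bsub>C\<^esub> d n j = d (n - 1) (j - 1) \<cdot>\<^bsub>C\<^esub> d n i)"

definition very_weakly_simplicial ::
  "('o, 'm, 'x) moncat_scheme \<Rightarrow> (nat \<Rightarrow> 'o) \<Rightarrow> (nat \<Rightarrow> nat \<Rightarrow> 'm) \<Rightarrow> (nat \<Rightarrow> nat \<Rightarrow> 'm) \<Rightarrow> bool" where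
  "very_weakly_simplicial C X d s \<longleftrightarrow>
     presimplicial C X d \<and>
     (\<forall>n i. 1 \<le> i \<and> i \<le> n \<longrightarrow> s n i \<in> Hom C (X n) (X (n + 1))) \<and>
     (\<forall>n i j. 1 \<le> i \<and> i \<le> j \<and> j \<le> n \<longrightarrow>
        s (n + 1) i \<cdot>\<^bsub>C\<^esub> s n j = s (n + 1) (j + 1) \<cdot>\<^bsub>C\<^esub> s n i) \<and>
     (\<forall>n i j. 1 \<le> i \<and> i < j \<and> j \<le> n \<longrightarrow>
        d (n + 1) i \<cdot>\<^bsub>C\<^esub> s n j = s (n - 1) (j - 1) \<cdot>\<^bsub>C\<^esub> d n i) \<and>
     (\<forall>n i j. 1 \<le> j \<and> j + 1 < i \<and> i \<le> n + 1 \<longrightarrow>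
        d (n + 1) i \<cdot>\<^bsub>C\<^esub> s n j = s (n - 1) j \<cdot>\<^bsub>C\<^esub> d n (i - 1))"

definition weakly_simplicial ::
  "('o, 'm, 'x) moncat_scheme \<Rightarrow> (nat \<Rightarrow> 'o) \<Rightarrow> (nat \<Rightarrow> nat \<Rightarrow> 'm) \<Rightarrow> (nat \<Rightarrow> nat \<Rightarrow> 'm) \<Rightarrow> bool" where
  "weakly_simplicial C X d s \<longleftrightarrow>
     very_weakly_simplicial C X d s \<and>
     (\<forall>n i. 1 \<le> i \<and> i \<le> n \<longrightarrow> d (n + 1) i \<cdot>\<^bsub>C\<^esub> s n i = d (n + 1) (i + 1) \<cdot>\<^bsub>C\<^esub> s n i)"

definition pre_bisimplicial ::
  "('o, 'm, 'x) moncat_scheme \<Rightarrow> (nat \<Rightarrow> 'o) \<Rightarrow> (nat \<Rightarrow> nat \<Rightarrow> 'm) \<Rightarrow> (nat \<Rightarrow> nat \<Rightarrow> 'm) \<Rightarrow> bool" where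
  "pre_bisimplicial C X d d' \<longleftrightarrow>
     presimplicial C X d \<and> presimplicial C X d' \<and>
     (\<forall>n i j. 1 \<le> i \<and> i < j \<and> j \<le> n \<longrightarrow>
        d (n - 1) i \<cdot>\<^bsub>C\<^esub> d' n j = d' (n - 1) (j - 1) \<cdot>\<^bsub>C\<^esub> d n i \<and>
        d' (n - 1) i \<cdot>\<^bsub>C\<^esub> d n j = d (n - 1) (j - 1) \<cdot>\<^bsub>C\<^esub> d' n i)"

definition very_weakly_bisimplicial ::
  "('o, 'm, 'x) moncat_scheme \<Rightarrow> (nat \<Rightarrow> 'o) \<Rightarrow> (nat \<Rightarrow> nat \<Rightarrow> 'm) \<Rightarrow> (nat \<Rightarrow> nat \<Rightarrow> 'm) \<Rightarrow>
   (nat \<Rightarrow> nat \<Rightarrow> 'm) \<Rightarrow> bool" where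
  "very_weakly_bisimplicial C X d d' s \<longleftrightarrow>
     pre_bisimplicial C X d d' \<and>
     very_weakly_simplicial C X d s \<and> very_weakly_simplicial C X d' s"

definition weakly_bisimplicial ::
  "('o, 'm, 'x) moncat_scheme \<Rightarrow> (nat \<Rightarrow> 'o) \<Rightarrow> (nat \<Rightarrow> nat \<Rightarrow> 'm) \<Rightarrow> (nat \<Rightarrow> nat \<Rightarrow> 'm) \<Rightarrow>
   (nat \<Rightarrow> nat \<Rightarrow> 'm) \<Rightarrow> bool" where
  "weakly_bisimplicial C X d d' s \<longleftrightarrow>
     pre_bisimplicial C X d d' \<and>
     weakly_simplicial C X d s \<and> weakly_simplicial C X d' s"

end

theory Submission
  imports Defs
begin

text \<open>
  Write \<open>\<sigma>\<^sub>i\<close> for the pre-braiding on the strands \<open>i\<close> and \<open>i + 1\<close>. The face \<open>d\<^sub>n\<^sub>;\<^sub>i\<close> pulls strand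
  \<open>i\<close> across its left neighbours to the left end and evaluates it there by \<open>\<epsilon>\<close>. Two properties of
  this picture carry almost everything: the recursion \<open>d\<^sub>n\<^sub>;\<^sub>1 = \<epsilon>\<^sub>1\<close>, \<open>d\<^sub>n\<^sub>;\<^sub>i\<^sub>+\<^sub>1 = d\<^sub>n\<^sub>;\<^sub>i \<circ>
  \<sigma>\<^sub>i\<close> (\<open>left_face_Suc\<close>), and the locality \<open>d\<^sub>n\<^sub>;\<^sub>i = d\<^sub>i\<^sub>;\<^sub>i \<otimes> Id\<close> (\<open>left_face_eq_ext\<close>). By
  locality and the exchange law, a face slides past every morphism that acts to the right of
  strand \<open>i\<close> (\<open>left_face_slide\<close>). A simplicial identity between neighbouring indices comes from
  one algebraic axiom: the braid relation together with \<open>(\<epsilon> \<otimes> \<epsilon>) \<circ> \<sigma> = \<epsilon> \<otimes> \<epsilon>\<close> for two faces, the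
  compatibility of \<open>\<sigma>\<close> and \<open>\<Delta>\<close> for a face and a degeneracy, coassociativity for two degeneracies,
  and \<open>\<sigma> \<circ> \<Delta> = \<Delta>\<close> for the weak structure. The recursion then moves the indices apart by induction.
  Right faces behave in the mirror-symmetric way. When the strands of a left and a right face
  cross, the two sides are the same braid by the braid relation, followed by the same evaluations;
  so \<open>\<epsilon>\<close> and \<open>\<zeta>\<close> can be chosen independently.

  The recursion presupposes that \<open>T\<^sub>s\<close> is known for the two permutations that move one strand to
  an end. For these permutations the shortest word is unique, so the choice in the definition of
  \<open>T\<^sub>s\<close> is forced: a strand that travels from position \<open>i\<close> to position \<open>1\<close> must be moved at least
  \<open>i - 1\<close> times by adjacent transpositions, and a word with exactly \<open>i - 1\<close> letters has to push it
  left with every letter (\<open>descending_word_unique\<close>). Shuffles with a block of size one are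
  precisely the inverses of such moves (\<open>monotone_off_point_eq_inverse_moves\<close>), so the shuffle
  maps for \<open>- \<sigma>\<close> expand into signed sums over the strand that is moved, and the two differentials
  are the alternating sums of the faces (\<open>left_d_eq\<close>, \<open>right_d_eq\<close>).

  The rest is general homological algebra in a preadditive category. In a composite of two
  alternating sums the identity \<open>d\<^sub>i d'\<^sub>j = d'\<^sub>j\<^sub>-\<^sub>1 d\<^sub>i\<close> for \<open>i < j\<close> matches the index pair \<open>(i,
  j)\<close> with \<open>(j - 1, i)\<close>, which has the opposite sign; so everything cancels
  (\<open>alternating_pairs_cancel\<close>). A family \<open>e\<^sub>n\<close> that commutes with the first \<open>n\<close> faces and is a
  section of the last one gives a contracting homotopy \<open>(- 1)\<^sup>n e\<^sub>n\<close>
  (\<open>extra_degeneracy_contracting\<close>). Take \<open>e\<^sub>n = Id \<otimes> \<eta>\<close>. For the left faces the first condition is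
  locality, and the second one follows from demi-naturality and normalization. For the right faces
  the first condition follows from right compatibility, and the second one is normalization.
\<close>


section \<open>Words for the moves of one strand\<close>

lemma word_perm_simps [simp]:
  "word_perm [] = id"
  "word_perm (a # w) = transpose a (Suc a) \<circ> word_perm w"
  by (simp_all add: word_perm_def)

lemma word_perm_append [simp]: "word_perm (u @ v) = word_perm u \<circ> word_perm v"
  by (induction u) (auto simp: fun_eq_iff)

text \<open>
  The last letter of a word acts first. Following the single point \<open>i\<close> through the word, each
  letter changes its position by at most one; if the word is as short as the distance travelled,
  then every letter must lower the position, which determines the letters one after the other.
\<close>

lemma descending_word_unique:
  assumes "word_perm w i = k"
  shows "i \<le> k + length w \<and> (i = k + length w \<longrightarrow> w = [k..<i])"
  using assms
proof (induction w arbitrary: k)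
  case (Cons a w)
  define k' where "k' = word_perm w i"
  have IH: "i \<le> k' + length w \<and> (i = k' + length w \<longrightarrow> w = [k'..<i])"
    using Cons.IH[OF k'_def[symmetric]] .
  have "transpose a (Suc a) k' = k"
    using Cons.prems k'_def by simp
  then consider "k' = Suc a" "k = a" | "k' \<le> k"
    unfolding transpose_def by (fastforce split: if_splits)
  then show ?case
  proof cases
    case 1
    have "a # w = [a..<i]" if "i = a + length (a # w)"
    proof -
      have "w = [Suc a..<i]" using IH 1 that by simp
      moreover have "a < i" using that by simp
      ultimately show ?thesis by (simp only: upt_conv_Cons)
    qed
    with IH 1 show ?thesis by simp
  qed (use IH in simp)
qed simp

text \<open>
  The same argument as for descending words, for a point that travels upwards.
\<close>

lemma ascending_word_unique:
  assumes "word_perm w i = k"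
  shows "k \<le> i + length w \<and> (k = i + length w \<longrightarrow> w = rev [i..<k])"
  using assms
proof (induction w arbitrary: k)
  case (Cons a w)
  define k' where "k' = word_perm w i"
  have IH: "k' \<le> i + length w \<and> (k' = i + length w \<longrightarrow> w = rev [i..<k'])"
    using Cons.IH[OF k'_def[symmetric]] .
  have "transpose a (Suc a) k' = k"
    using Cons.prems k'_def by simp
  then consider "k' = a" "k = Suc a" | "k \<le> k'"
    unfolding transpose_def by (fastforce split: if_splits)
  then show ?case
  proof cases
    case 1
    have "a # w = rev [i..<Suc a]" if "Suc a = i + length (a # w)"
    proof -
      have "w = rev [i..<a]" using IH 1 that by simp
      moreover have "i \<le> a" using that by simp
      ultimately show ?thesis by (simp only: upt_Suc_append rev_append) simp
    qed
    with IH 1 show ?thesis by simp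
  qed (use IH in simp)
qed simp

lemma word_perm_descending:
  assumes "1 \<le> i"
  shows "word_perm [1..<i] = move_left i"
  using assms
proof (induction i rule: dec_induct)
  case base
  show ?case by (auto simp: move_left_def fun_eq_iff)
next
  case (step i)
  then show ?case
    by (auto simp: move_left_def fun_eq_iff transpose_def)
qed

lemma word_perm_ascending:
  assumes "i \<le> n"
  shows "word_perm (rev [i..<n]) = move_right n i"
  using assms
proof (induction n rule: dec_induct)
  case base
  show ?case by (auto simp: move_right_def fun_eq_iff)
next
  case (step n)
  then show ?case
    by (auto simp: move_right_def fun_eq_iff transpose_def)
qed

text \<open>
  Since only one word attains the minimal length, the choice operator has no freedom.
\<close>

lemma shortest_word_move_left:
  assumes "1 \<le> i" "i \<le> n"
  shows "(SOME w. shortest_word n (move_left i) w) = [1..<i]"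
proof (rule some_equality)
  show *: "shortest_word n (move_left i) [1..<i]"
    unfolding shortest_word_def
  proof (intro conjI allI impI)
    fix w assume "set w \<subseteq> {1..<n} \<and> word_perm w = move_left i"
    then have "word_perm w i = 1" by (simp add: move_left_def)
    from descending_word_unique[OF this, THEN conjunct1] show "length [1..<i] \<le> length w" by simp
  qed (use assms word_perm_descending in auto)
  fix w assume w: "shortest_word n (move_left i) w"
  then have "word_perm w i = 1" by (simp add: shortest_word_def move_left_def)
  note bound = descending_word_unique[OF this]
  have "length w \<le> i - 1"
    using w * unfolding shortest_word_def by (metis length_upt)
  then have "i = 1 + length w" using bound assms by linarith
  with bound show "w = [1..<i]" by blast
qed

lemma shortest_word_move_right:
  assumes "1 \<le> i" "i \<le> n"
  shows "(SOME w. shortest_word n (move_right n i) w) = rev [i..<n]"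
proof (rule some_equality)
  show *: "shortest_word n (move_right n i) (rev [i..<n])"
    unfolding shortest_word_def
  proof (intro conjI allI impI)
    fix w assume "set w \<subseteq> {1..<n} \<and> word_perm w = move_right n i"
    then have "word_perm w i = n" by (simp add: move_right_def)
    from ascending_word_unique[OF this, THEN conjunct1] show "length (rev [i..<n]) \<le> length w" by simp
  qed (use assms word_perm_ascending in auto)
  fix w assume w: "shortest_word n (move_right n i) w"
  then have "word_perm w i = n" by (simp add: shortest_word_def move_right_def)
  note bound = ascending_word_unique[OF this]
  have "length w \<le> n - i"
    using w * unfolding shortest_word_def by (metis length_rev length_upt)
  then have "n = i + length w" using bound assms by linarith
  with bound show "w = rev [i..<n]" by blast
qed


section \<open>Shuffles with a block of size one\<close>

text \<open>
  Induction on the points: once all smaller points are fixed, \<open>t x < x\<close> contradicts injectivity,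
  and \<open>t x > x\<close> would leave \<open>x\<close> to be the value of a larger point, against monotonicity.
\<close>

lemma strict_mono_permutation_id:
  fixes t :: "nat \<Rightarrow> nat"
  assumes t: "t permutes A" and mono: "strict_mono_on A t"
  shows "t = id"
proof
  fix x
  show "t x = id x"
  proof (induction x rule: less_induct)
    case (less x)
    have inj: "inj t" using t permutes_inj by blast
    show ?case
    proof (cases "x \<in> A")
      case True
      have ge: "x \<le> t x"
      proof (rule ccontr)
        assume "\<not> x \<le> t x"
        then have "t (t x) = t x" using less by simp
        then have "t x = x" by (rule injD[OF inj])
        with \<open>\<not> x \<le> t x\<close> show False by simp
      qed
      obtain y where y: "t y = x" using t permutes_surj by (metis surjD)
      have "y \<in> A" using y True t by (metis permutes_not_in)
      have "\<not> y < x" using less[of y] y by auto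
      moreover have "\<not> x < y"
        using ge y strict_mono_onD[OF mono True \<open>y \<in> A\<close>] by auto
      ultimately show ?thesis using y by simp
    qed (use t in \<open>simp add: permutes_def\<close>)
  qed
qed

text \<open>
  One combinatorial fact covers both kinds of shuffles with a singleton block: \<open>m i\<close> is the move
  of element \<open>i\<close> to the end \<open>e\<close>. If \<open>s\<close> is monotone away from \<open>e\<close> and \<open>i = s e\<close>, then \<open>m i \<circ> s\<close>
  fixes \<open>e\<close> and is monotone elsewhere, hence it is the identity.
\<close>

lemma monotone_off_point_eq_inverse_moves:
  fixes m :: "nat \<Rightarrow> nat \<Rightarrow> nat"
  assumes perm: "\<And>i. i \<in> A \<Longrightarrow> m i permutes A"
    and mono: "\<And>i. i \<in> A \<Longrightarrow> strict_mono_on (A - {i}) (m i)"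
    and target: "\<And>i. i \<in> A \<Longrightarrow> m i i = e" and e: "e \<in> A"
  shows "{s. s permutes A \<and> strict_mono_on (A - {e}) s} = (\<lambda>i. inv_into UNIV (m i)) ` A"
    and "inj_on (\<lambda>i. inv_into UNIV (m i)) A"
proof -
  have inv_e: "inv_into UNIV (m i) e = i" if "i \<in> A" for i
    using perm[OF that] target[OF that] permutes_inverses(2) by metis
  show "inj_on (\<lambda>i. inv_into UNIV (m i)) A"
    by (rule inj_onI) (metis inv_e)
  show "{s. s permutes A \<and> strict_mono_on (A - {e}) s} = (\<lambda>i. inv_into UNIV (m i)) ` A"
  proof (intro equalityI subsetI)
    fix s assume "s \<in> {s. s permutes A \<and> strict_mono_on (A - {e}) s}"
    then have s: "s permutes A" and smono: "strict_mono_on (A - {e}) s" by auto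
    define i where "i = s e"
    have i: "i \<in> A" using s e by (simp add: i_def permutes_in_image)
    have range: "s x \<in> A - {i}" if "x \<in> A - {e}" for x
      using that s inj_eq[OF permutes_inj[OF s]] by (simp add: i_def permutes_in_image)
    have "m i \<circ> s permutes A" using s perm[OF i] by (rule permutes_compose)
    moreover have "(m i \<circ> s) e = e" using target[OF i] by (simp add: i_def)
    ultimately have "m i \<circ> s permutes A - {e}"
      by (auto intro: permutes_superset)
    moreover have "strict_mono_on (A - {e}) (m i \<circ> s)"
      using range smono mono[OF i]
      by (intro strict_mono_onI) (simp, metis DiffI singletonD strict_mono_onD)
    ultimately have "m i \<circ> s = id" by (rule strict_mono_permutation_id)
    then have "inv_into UNIV (m i) = s"
      by (metis comp_assoc fun.map_id0 id_o id_comp o_id perm[OF i] permutes_inv_o(2))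
    with i show "s \<in> (\<lambda>i. inv_into UNIV (m i)) ` A" by blast
  next
    fix s assume "s \<in> (\<lambda>i. inv_into UNIV (m i)) ` A"
    then obtain i where i: "i \<in> A" and s: "s = inv_into UNIV (m i)" by blast
    have sp: "s permutes A" using s perm[OF i] permutes_inv by blast
    have ms: "m i (s x) = x" for x using s perm[OF i] permutes_inverses(1) by metis
    have range: "s x \<in> A - {i}" if "x \<in> A - {e}" for x
      using that sp ms[of x] target[OF i] by (auto simp: permutes_in_image)
    have "s x < s y" if "x \<in> A - {e}" "y \<in> A - {e}" "x < y" for x y
    proof (rule ccontr)
      assume "\<not> s x < s y"
      then have "s y < s x \<or> s y = s x" by auto
      then have "m i (s y) \<le> m i (s x)"
        using strict_mono_onD[OF mono[OF i] range range] that by fastforce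
      with that(3) show False by (simp add: ms)
    qed
    with sp show "s \<in> {s. s permutes A \<and> strict_mono_on (A - {e}) s}"
      by (auto intro: strict_mono_onI)
  qed
qed

lemma permutes_word_perm:
  assumes "set w \<subseteq> {1..<n}"
  shows "word_perm w permutes {1..n}"
  using assms
proof (induction w)
  case (Cons a w)
  then have "transpose a (Suc a) permutes {1..n}"
    by (intro permutes_swap_id) auto
  moreover have "word_perm w permutes {1..n}" using Cons by simp
  ultimately show ?case unfolding word_perm_simps by (intro permutes_compose)
qed (simp add: permutes_id[unfolded id_def] id_def)

lemma Sh_left_eq:
  assumes "1 \<le> n"
  shows "Sh 1 (n - 1) = (\<lambda>i. inv_into UNIV (move_left i)) ` {1..n}"
    and "inj_on (\<lambda>i. inv_into UNIV (move_left i)) {1..n}"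
proof -
  have perm: "move_left i permutes {1..n}" if "i \<in> {1..n}" for i
    using permutes_word_perm[of "[1..<i]" n] that word_perm_descending[of i] by auto
  have mono: "strict_mono_on ({1..n} - {i}) (move_left i)" for i
    by (rule strict_mono_onI) (auto simp: move_left_def)
  have target: "move_left i i = 1" for i by (simp add: move_left_def)
  have e: "1 \<in> {1..n}" using assms by simp
  note moves = monotone_off_point_eq_inverse_moves[where m = move_left, OF perm mono target e]
  have "{1..n} - {1} = {2..n}" "strict_mono_on {1..1::nat} s" for s :: "nat \<Rightarrow> nat"
    by (auto intro: strict_mono_onI)
  then have "Sh 1 (n - 1) = {s. s permutes {1..n} \<and> strict_mono_on ({1..n} - {1}) s}"
    using assms by (simp add: Sh_def numeral_2_eq_2)
  with moves show "Sh 1 (n - 1) = (\<lambda>i. inv_into UNIV (move_left i)) ` {1..n}"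
    and "inj_on (\<lambda>i. inv_into UNIV (move_left i)) {1..n}" by simp_all
qed

lemma Sh_right_eq:
  assumes "1 \<le> n"
  shows "Sh (n - 1) 1 = (\<lambda>i. inv_into UNIV (move_right n i)) ` {1..n}"
    and "inj_on (\<lambda>i. inv_into UNIV (move_right n i)) {1..n}"
proof -
  have perm: "move_right n i permutes {1..n}" if "i \<in> {1..n}" for i
    using permutes_word_perm[of "rev [i..<n]" n] that word_perm_ascending[of i n] by auto
  have mono: "strict_mono_on ({1..n} - {i}) (move_right n i)" for i
    by (rule strict_mono_onI) (auto simp: move_right_def)
  have target: "move_right n i i = n" for i by (simp add: move_right_def)
  have e: "n \<in> {1..n}" using assms by simp
  note moves = monotone_off_point_eq_inverse_moves[where m = "move_right n", OF perm mono target e]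
  have "{1..n} - {n} = {1..n - 1}" "strict_mono_on {n} s" for s :: "nat \<Rightarrow> nat"
    by (auto intro: strict_mono_onI)
  then have "Sh (n - 1) 1 = {s. s permutes {1..n} \<and> strict_mono_on ({1..n} - {n}) s}"
    using assms by (simp add: Sh_def)
  with moves show "Sh (n - 1) 1 = (\<lambda>i. inv_into UNIV (move_right n i)) ` {1..n}"
    and "inj_on (\<lambda>i. inv_into UNIV (move_right n i)) {1..n}" by simp_all
qed


section \<open>Composition and addition of morphisms\<close>

context category
begin

lemma Hom_Obj: "f \<in> Hom C A B \<Longrightarrow> A \<in> Obj C \<and> B \<in> Obj C"
  using dom_Obj cod_Obj by (auto simp: Hom_def)

lemma Hom_Arr: "f \<in> Hom C A B \<Longrightarrow> f \<in> Arr C"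
  by (simp add: Hom_def)

lemma Arr_comp [simp]: "\<lbrakk>f \<in> Arr C; g \<in> Arr C; cod C f = dom C g\<rbrakk> \<Longrightarrow> g \<cdot> f \<in> Arr C"
  and dom_comp [simp]: "\<lbrakk>f \<in> Arr C; g \<in> Arr C; cod C f = dom C g\<rbrakk> \<Longrightarrow> dom C (g \<cdot> f) = dom C f"
  and cod_comp [simp]: "\<lbrakk>f \<in> Arr C; g \<in> Arr C; cod C f = dom C g\<rbrakk> \<Longrightarrow> cod C (g \<cdot> f) = cod C g"
  using comp_hom[of f "dom C f" "cod C f" g "cod C g"] by (auto simp: Hom_def)

lemma seq_assoc:
  "\<lbrakk>f \<in> Arr C; g \<in> Arr C; h \<in> Arr C; cod C f = dom C g; cod C g = dom C h\<rbrakk>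
    \<Longrightarrow> (h \<cdot> g) \<cdot> f = h \<cdot> (g \<cdot> f)"
  using comp_assoc[of f "dom C f" "cod C f" g "cod C g" h "cod C h"] by (simp add: Hom_def)

text \<open>
  A two-step identity used in front of further factors. Compositions are kept right-nested, so an
  equation between composites of two morphisms does not match inside a longer composite without
  this form.
\<close>

lemma comp_slide:
  assumes "g \<cdot> f = g' \<cdot> f'" "x \<in> Arr C" "f \<in> Arr C" "g \<in> Arr C" "f' \<in> Arr C" "g' \<in> Arr C"
    "cod C x = dom C f" "cod C f = dom C g" "cod C x = dom C f'" "cod C f' = dom C g'"
  shows "g \<cdot> (f \<cdot> x) = g' \<cdot> (f' \<cdot> x)"
  using assms by (simp add: seq_assoc[symmetric])

end

context strict_monoidal_category
begin

lemma tens_comp_whisker: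
  assumes f: "f \<in> Hom C A B" and g: "g \<in> Hom C A' B'"
  shows "(f \<otimes>\<^sub>m Id C B') \<cdot> (Id C A \<otimes>\<^sub>m g) = f \<otimes>\<^sub>m g"
    and "(Id C B \<otimes>\<^sub>m g) \<cdot> (f \<otimes>\<^sub>m Id C A') = f \<otimes>\<^sub>m g"
proof -
  note objs = Hom_Obj[OF f] Hom_Obj[OF g]
  show "(f \<otimes>\<^sub>m Id C B') \<cdot> (Id C A \<otimes>\<^sub>m g) = f \<otimes>\<^sub>m g"
    using interchange[OF Id_hom f g Id_hom] objs
    by (simp add: comp_Id_left[OF g] comp_Id_right[OF f])
  show "(Id C B \<otimes>\<^sub>m g) \<cdot> (f \<otimes>\<^sub>m Id C A') = f \<otimes>\<^sub>m g"
    using interchange[OF f Id_hom Id_hom g] objs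
    by (simp add: comp_Id_right[OF g] comp_Id_left[OF f])
qed

end

lemma group_hom_finprod:
  assumes "comm_group G" "comm_group H" "h \<in> hom G H" "f \<in> S \<rightarrow> carrier G"
  shows "h (finprod G f S) = finprod H (\<lambda>x. h (f x)) S"
proof -
  interpret G: comm_group G by fact
  interpret H: comm_group H by fact
  interpret group_hom G H h
    using assms(3) by unfold_locales
  show ?thesis
    using assms(4)
  proof (induction S rule: infinite_finite_induct)
    case (insert x S)
    then have "f x \<in> carrier G" "f \<in> S \<rightarrow> carrier G" "h (f x) \<in> carrier H" "(\<lambda>x. h (f x)) \<in> S \<rightarrow> carrier H"
      by (auto simp: Pi_iff)
    with insert show ?case by simp
  qed simp_all
qed

context preadditive_strict_monoidal_category
begin

lemma hom_group_simps [simp]: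
  "carrier (hom_group C A B) = Hom C A B"
  "monoid.mult (hom_group C A B) = madd C"
  "one (hom_group C A B) = mzero C A B"
  by (simp_all add: hom_group_def)

lemma smul_eq: "f \<in> Hom C A B \<Longrightarrow> smul C k f = f [^]\<^bsub>hom_group C A B\<^esub> k"
  by (simp add: smul_def Hom_def)

lemma mneg_eq_smul:
  assumes "f \<in> Hom C A B"
  shows "mneg C f = smul C (- 1) f"
proof -
  interpret comm_group "hom_group C A B" using assms Hom_Obj hom_comm_group by blast
  have "f \<in> carrier (hom_group C A B)" using assms by simp
  then have "f [^]\<^bsub>hom_group C A B\<^esub> (- 1 :: int) = m_inv (hom_group C A B) f"
    using int_pow_neg[of f 1] by simp
  then show ?thesis using assms by (simp add: smul_eq) (simp add: mneg_def Hom_def)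
qed

lemma smul_hom:
  assumes "f \<in> Hom C A B"
  shows "smul C k f \<in> Hom C A B"
proof -
  interpret comm_group "hom_group C A B" using assms Hom_Obj hom_comm_group by blast
  show ?thesis using assms int_pow_closed[of f k] by (simp add: smul_eq)
qed

lemma smul_one:
  assumes "f \<in> Hom C A B"
  shows "smul C 1 f = f"
proof -
  interpret comm_group "hom_group C A B" using assms Hom_Obj hom_comm_group by blast
  show ?thesis using assms int_pow_1[of f] by (simp add: smul_eq)
qed

lemma smul_smul:
  assumes "f \<in> Hom C A B"
  shows "smul C k (smul C l f) = smul C (k * l) f"
proof -
  interpret comm_group "hom_group C A B" using assms Hom_Obj hom_comm_group by blast
  show ?thesis
    using assms int_pow_pow[of f l k] smul_eq[OF assms] smul_eq[OF smul_hom[OF assms]]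
    by (simp add: mult.commute)
qed

lemma msum_hom:
  assumes "A \<in> Obj C" "B \<in> Obj C" "\<And>x. x \<in> S \<Longrightarrow> f x \<in> Hom C A B"
  shows "msum C A B f S \<in> Hom C A B"
proof -
  interpret comm_group "hom_group C A B" using assms hom_comm_group by blast
  show ?thesis unfolding msum_def using finprod_closed[of f S] assms(3) by (auto simp: Pi_iff)
qed

text \<open>
  Composition on either side, multiplication by an integer and padding with identities are all
  additive in a morphism variable; this is the common reason why they commute with multiples and
  sums.
\<close>

lemma additive_map:
  assumes objs: "A \<in> Obj C" "B \<in> Obj C" "A' \<in> Obj C" "B' \<in> Obj C"
    and "\<And>f. f \<in> Hom C A B \<Longrightarrow> F f \<in> Hom C A' B'"
    and "\<And>f g. \<lbrakk>f \<in> Hom C A B; g \<in> Hom C A B\<rbrakk> \<Longrightarrow> F (f +\<^sub>m g) = F f +\<^sub>m F g"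
  shows "\<And>f k. f \<in> Hom C A B \<Longrightarrow> F (smul C k f) = smul C k (F f)"
    and "\<And>f S. (\<And>x. x \<in> S \<Longrightarrow> f x \<in> Hom C A B)
      \<Longrightarrow> F (msum C A B f S) = msum C A' B' (\<lambda>x. F (f x)) S"
proof -
  interpret G: comm_group "hom_group C A B" using objs hom_comm_group by blast
  interpret H: comm_group "hom_group C A' B'" using objs hom_comm_group by blast
  have F: "F \<in> hom (hom_group C A B) (hom_group C A' B')"
    using assms(5,6) by (auto simp: hom_def)
  fix k
  show "F (smul C k f) = smul C k (F f)" if "f \<in> Hom C A B" for f
    using hom_int_pow[OF F _ G.is_group H.is_group, of f k] that smul_eq[OF assms(5)[OF that]]
    by (simp add: smul_eq)
  show "F (msum C A B f S) = msum C A' B' (\<lambda>x. F (f x)) S"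
    if "\<And>x. x \<in> S \<Longrightarrow> f x \<in> Hom C A B" for f S
    unfolding msum_def
    using that by (intro group_hom_finprod[OF G.comm_group_axioms H.comm_group_axioms F]) auto
qed

lemma comp_smul_right:
  assumes h: "h \<in> Hom C B D" and f: "f \<in> Hom C A B"
  shows "h \<cdot> smul C k f = smul C k (h \<cdot> f)"
  using Hom_Obj[OF h] Hom_Obj[OF f]
  by (intro additive_map(1)[of A B A D "\<lambda>f. h \<cdot> f"] comp_hom[OF _ h] comp_add_right[OF _ _ h] f) auto

lemma comp_msum_right:
  assumes h: "h \<in> Hom C B D" and A: "A \<in> Obj C" and f: "\<And>x. x \<in> S \<Longrightarrow> f x \<in> Hom C A B"
  shows "h \<cdot> msum C A B f S = msum C A D (\<lambda>x. h \<cdot> f x) S"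
  using Hom_Obj[OF h] A
  by (intro additive_map(2)[of A B A D "\<lambda>f. h \<cdot> f"] comp_hom[OF _ h] comp_add_right[OF _ _ h] f) auto

lemma comp_smul_left:
  assumes h: "h \<in> Hom C A B" and f: "f \<in> Hom C B D"
  shows "smul C k f \<cdot> h = smul C k (f \<cdot> h)"
  using Hom_Obj[OF h] Hom_Obj[OF f]
  by (intro additive_map(1)[of B D A D "\<lambda>f. f \<cdot> h"] comp_hom[OF h] comp_add_left[OF h] f) auto

lemma comp_msum_left:
  assumes h: "h \<in> Hom C A B" and D: "D \<in> Obj C" and f: "\<And>x. x \<in> S \<Longrightarrow> f x \<in> Hom C B D"
  shows "msum C B D f S \<cdot> h = msum C A D (\<lambda>x. f x \<cdot> h) S"
  using Hom_Obj[OF h] D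
  by (intro additive_map(2)[of B D A D "\<lambda>f. f \<cdot> h"] comp_hom[OF h] comp_add_left[OF h] f) auto

lemma smul_add:
  assumes f: "f \<in> Hom C A B" and g: "g \<in> Hom C A B"
  shows "smul C k (f +\<^sub>m g) = smul C k f +\<^sub>m smul C k g"
proof -
  interpret G: comm_group "hom_group C A B" using Hom_Obj[OF f] hom_comm_group by blast
  have "f +\<^sub>m g \<in> Hom C A B" using G.m_closed[of f g] f g by simp
  then show ?thesis
    using G.int_pow_distrib[of f g k] f g by (simp add: smul_eq)
qed

lemma smul_msum:
  assumes "A \<in> Obj C" "B \<in> Obj C" "\<And>x. x \<in> S \<Longrightarrow> f x \<in> Hom C A B"
  shows "smul C k (msum C A B f S) = msum C A B (\<lambda>x. smul C k (f x)) S"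
proof -
  show ?thesis
    using additive_map(2)[of A B A B "smul C k" S f] assms smul_hom smul_add by blast
qed

lemma comp_smul_smul:
  assumes f: "f \<in> Hom C A B" and g: "g \<in> Hom C B D"
  shows "smul C k g \<cdot> smul C l f = smul C (k * l) (g \<cdot> f)"
proof -
  have "smul C k g \<cdot> smul C l f = smul C k (g \<cdot> smul C l f)"
    by (rule comp_smul_left[OF smul_hom[OF f] g])
  also have "g \<cdot> smul C l f = smul C l (g \<cdot> f)"
    by (rule comp_smul_right[OF g f])
  also have "smul C k (smul C l (g \<cdot> f)) = smul C (k * l) (g \<cdot> f)"
    by (rule smul_smul[OF comp_hom[OF f g]])
  finally show ?thesis .
qed

lemma msum_cong:
  assumes "A \<in> Obj C" "B \<in> Obj C" "\<And>x. x \<in> S \<Longrightarrow> f x = g x" "\<And>x. x \<in> S \<Longrightarrow> g x \<in> Hom C A B"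
  shows "msum C A B f S = msum C A B g S"
proof -
  interpret G: comm_group "hom_group C A B" using assms hom_comm_group by blast
  show ?thesis unfolding msum_def using assms(3,4) by (intro G.finprod_cong') auto
qed

lemma msum_reindex:
  assumes "A \<in> Obj C" "B \<in> Obj C" "inj_on h S" "\<And>x. x \<in> S \<Longrightarrow> f (h x) \<in> Hom C A B"
  shows "msum C A B f (h ` S) = msum C A B (\<lambda>x. f (h x)) S"
proof -
  interpret G: comm_group "hom_group C A B" using assms hom_comm_group by blast
  show ?thesis unfolding msum_def using assms(3,4) by (intro G.finprod_reindex) auto
qed

lemma msum_Times:
  assumes objs: "A \<in> Obj C" "B \<in> Obj C" and "finite S" "finite T"
    and "\<And>x y. \<lbrakk>x \<in> S; y \<in> T\<rbrakk> \<Longrightarrow> f x y \<in> Hom C A B"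
  shows "msum C A B (\<lambda>x. msum C A B (f x) T) S = msum C A B (\<lambda>(x, y). f x y) (S \<times> T)"
  using assms(3,5)
proof (induction S rule: finite_induct)
  case empty
  interpret G: comm_group "hom_group C A B" using objs hom_comm_group by blast
  show ?case by (simp add: msum_def)
next
  case (insert x S)
  interpret G: comm_group "hom_group C A B" using objs hom_comm_group by blast
  let ?F = "\<lambda>(x, y). f x y"
  have F: "?F \<in> (insert x S) \<times> T \<rightarrow> Hom C A B" using insert.prems by auto
  have row: "finprod (hom_group C A B) ?F ({x} \<times> T) = msum C A B (f x) T"
  proof -
    have "{x} \<times> T = Pair x ` T" by auto
    then show ?thesis
      using G.finprod_reindex[of ?F "Pair x" T] F by (auto simp: msum_def Pi_iff inj_on_def)
  qed
  have rows: "msum C A B (f y) T \<in> Hom C A B" if "y \<in> insert x S" for y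
    using that insert.prems objs by (intro msum_hom) auto
  have split: "insert x S \<times> T = ({x} \<times> T) \<union> (S \<times> T)" by auto
  have "msum C A B ?F (insert x S \<times> T)
      = finprod (hom_group C A B) ?F ({x} \<times> T) +\<^sub>m finprod (hom_group C A B) ?F (S \<times> T)"
    unfolding msum_def split using insert.hyps insert.prems \<open>finite T\<close>
    by (intro G.finprod_Un_disjoint[unfolded hom_group_simps]) auto
  also have "\<dots> = msum C A B (f x) T +\<^sub>m msum C A B (\<lambda>x. msum C A B (f x) T) S"
    using insert row by (simp add: msum_def)
  also have "\<dots> = msum C A B (\<lambda>x. msum C A B (f x) T) (insert x S)"
    using insert.hyps rows G.finprod_insert[of S x "\<lambda>x. msum C A B (f x) T"]
    by (auto simp: msum_def Pi_iff)
  finally show ?case by simp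
qed

end


section \<open>Alternating sums\<close>

text \<open>
  The combinatorial core of \<open>d \<circ> d = 0\<close>, in multiplicative notation: \<open>(i, j) \<mapsto> (j - 1, i)\<close> is a
  bijection from the pairs with \<open>i < j\<close> to those with \<open>j \<le> i\<close>, and it changes the parity of \<open>i +
  j\<close>. Two families \<open>a\<close> and \<open>b\<close> are kept apart so that the cancellation within one differential (\<open>a
  = b\<close>) and the cancellation between two anticommuting differentials are instances of it.
\<close>

lemma (in comm_group) alternating_pairs_cancel:
  fixes a b :: "nat \<Rightarrow> nat \<Rightarrow> 'a" and n :: nat
  assumes eq: "\<And>i j. \<lbrakk>1 \<le> i; i < j; j \<le> n\<rbrakk> \<Longrightarrow> a i j = b (j - 1) i"
    and closed: "\<And>i j. \<lbrakk>1 \<le> i; i < j; j \<le> n\<rbrakk> \<Longrightarrow> a i j \<in> carrier G"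
  shows "finprod G (\<lambda>(i, j). a i j [^] ((- 1) ^ (i + j) :: int)) {(i, j). 1 \<le> i \<and> i < j \<and> j \<le> n}
    \<otimes> finprod G (\<lambda>(i, j). b i j [^] ((- 1) ^ (i + j) :: int)) {(i, j). 1 \<le> j \<and> j \<le> i \<and> i < n} = \<one>"
    (is "finprod G ?f ?S \<otimes> finprod G ?g ?T = \<one>")
proof -
  define \<pi> where "\<pi> = (\<lambda>(i :: nat, j :: nat). (j - 1, i))"
  have image: "\<pi> ` ?S = ?T"
  proof (intro equalityI subsetI)
    fix p assume "p \<in> ?T"
    then obtain i j where "p = (i, j)" "1 \<le> j" "j \<le> i" "i < n" by auto
    then have "p = \<pi> (j, Suc i)" "(j, Suc i) \<in> ?S" by (auto simp: \<pi>_def)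
    then show "p \<in> \<pi> ` ?S" by blast
  qed (auto simp: \<pi>_def)
  have inj: "inj_on \<pi> ?S" by (auto simp: \<pi>_def inj_on_def)
  have f: "?f \<in> ?S \<rightarrow> carrier G" using closed by auto
  have cancel: "?g (\<pi> p) = inv (?f p)" if p: "p \<in> ?S" for p
  proof -
    obtain i j where ij: "p = (i, Suc j)" "1 \<le> i" "i \<le> j" "Suc j \<le> n"
    proof (cases p)
      case (Pair i k)
      with p show ?thesis by (intro that[of i "k - 1"]) auto
    qed
    then have "b j i = a i (Suc j)" "a i (Suc j) \<in> carrier G"
      using eq[of i "Suc j"] closed[of i "Suc j"] by auto
    with ij show ?thesis by (simp add: \<pi>_def add.commute flip: int_pow_neg)
  qed
  have "finprod G ?g ?T = finprod G (\<lambda>p. ?g (\<pi> p)) ?S"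
    unfolding image[symmetric]
  proof (rule finprod_reindex[OF _ inj])
    show "?g \<in> \<pi> ` ?S \<rightarrow> carrier G" using cancel f by (auto simp: Pi_iff simp del: split_paired_All)
  qed
  also have "\<dots> = finprod G (\<lambda>p. inv (?f p)) ?S"
    using f cancel by (intro finprod_cong') (auto simp: Pi_iff)
  finally have "finprod G ?f ?S \<otimes> finprod G ?g ?T = finprod G (\<lambda>p. ?f p \<otimes> inv (?f p)) ?S"
    using finprod_multf[of ?f ?S "\<lambda>p. inv (?f p)"] f by (simp add: Pi_iff)
  also have "\<dots> = \<one>" using f by (intro finprod_one_eqI) (auto simp: Pi_iff)
  finally show ?thesis .
qed

definition alternating_sum ::
  "('o, 'm, 'x) moncat_scheme \<Rightarrow> 'o \<Rightarrow> 'o \<Rightarrow> nat \<Rightarrow> (nat \<Rightarrow> 'm) \<Rightarrow> 'm" where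
  "alternating_sum C A B n f = msum C A B (\<lambda>i. smul C ((- 1) ^ (i - 1)) (f i)) {1..n}"

context preadditive_strict_monoidal_category
begin

lemma alternating_sum_hom:
  assumes "A \<in> Obj C" "B \<in> Obj C" "\<And>i. \<lbrakk>1 \<le> i; i \<le> n\<rbrakk> \<Longrightarrow> f i \<in> Hom C A B"
  shows "alternating_sum C A B n f \<in> Hom C A B"
  unfolding alternating_sum_def using assms by (intro msum_hom smul_hom) auto

lemma alternating_sum_cong:
  assumes "A \<in> Obj C" "B \<in> Obj C" "\<And>i. \<lbrakk>1 \<le> i; i \<le> n\<rbrakk> \<Longrightarrow> f i = g i"
    "\<And>i. \<lbrakk>1 \<le> i; i \<le> n\<rbrakk> \<Longrightarrow> g i \<in> Hom C A B"
  shows "alternating_sum C A B n f = alternating_sum C A B n g"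
  unfolding alternating_sum_def using assms by (intro msum_cong smul_hom) auto

lemma alternating_sum_Suc:
  assumes "A \<in> Obj C" "B \<in> Obj C" and f: "\<And>i. \<lbrakk>1 \<le> i; i \<le> Suc n\<rbrakk> \<Longrightarrow> f i \<in> Hom C A B"
  shows "alternating_sum C A B (Suc n) f = smul C ((- 1) ^ n) (f (Suc n)) +\<^sub>m alternating_sum C A B n f"
proof -
  interpret G: comm_group "hom_group C A B" using assms hom_comm_group by blast
  have "{1..Suc n} = insert (Suc n) {1..n}" by auto
  moreover have "(\<lambda>i. smul C ((- 1) ^ (i - 1)) (f i)) \<in> {1..n} \<rightarrow> Hom C A B"
    "smul C ((- 1) ^ n) (f (Suc n)) \<in> Hom C A B"
    using f smul_hom by auto
  ultimately show ?thesis
    using G.finprod_insert[of "{1..n}" "Suc n" "\<lambda>i. smul C ((- 1) ^ (i - 1)) (f i)"]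
    by (simp add: alternating_sum_def msum_def)
qed

lemma comp_alternating_sum_right:
  assumes h: "h \<in> Hom C B D" and A: "A \<in> Obj C" and f: "\<And>i. \<lbrakk>1 \<le> i; i \<le> n\<rbrakk> \<Longrightarrow> f i \<in> Hom C A B"
  shows "h \<cdot> alternating_sum C A B n f = alternating_sum C A D n (\<lambda>i. h \<cdot> f i)"
proof -
  have "h \<cdot> alternating_sum C A B n f
      = msum C A D (\<lambda>i. h \<cdot> smul C ((- 1) ^ (i - 1)) (f i)) {1..n}"
    unfolding alternating_sum_def using f by (intro comp_msum_right[OF h A] smul_hom) auto
  also have "\<dots> = alternating_sum C A D n (\<lambda>i. h \<cdot> f i)"
    unfolding alternating_sum_def using A Hom_Obj[OF h] f
    by (intro msum_cong comp_smul_right[OF h] smul_hom comp_hom[OF _ h]) auto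
  finally show ?thesis .
qed

lemma comp_alternating_sum_left:
  assumes h: "h \<in> Hom C A B" and D: "D \<in> Obj C" and f: "\<And>i. \<lbrakk>1 \<le> i; i \<le> n\<rbrakk> \<Longrightarrow> f i \<in> Hom C B D"
  shows "alternating_sum C B D n f \<cdot> h = alternating_sum C A D n (\<lambda>i. f i \<cdot> h)"
proof -
  have "alternating_sum C B D n f \<cdot> h
      = msum C A D (\<lambda>i. smul C ((- 1) ^ (i - 1)) (f i) \<cdot> h) {1..n}"
    unfolding alternating_sum_def using f by (intro comp_msum_left[OF h D] smul_hom) auto
  also have "\<dots> = alternating_sum C A D n (\<lambda>i. f i \<cdot> h)"
    unfolding alternating_sum_def using D Hom_Obj[OF h] f
    by (intro msum_cong comp_smul_left[OF h] smul_hom comp_hom[OF h]) auto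
  finally show ?thesis .
qed

text \<open>
  The double sum is split along the two ranges of indices that the simplicial relations exchange.
  It is phrased in the group of morphisms so that \<open>alternating_pairs_cancel\<close> applies to it.
\<close>

lemma comp_alternating_sums:
  assumes objs: "A \<in> Obj C" "B \<in> Obj C" "D \<in> Obj C" and n: "1 \<le> n"
    and f: "\<And>i. \<lbrakk>1 \<le> i; i < n\<rbrakk> \<Longrightarrow> f i \<in> Hom C B D"
    and g: "\<And>j. \<lbrakk>1 \<le> j; j \<le> n\<rbrakk> \<Longrightarrow> g j \<in> Hom C A B"
  defines "F \<equiv> \<lambda>(i, j). (f i \<cdot> g j) [^]\<^bsub>hom_group C A D\<^esub> ((- 1) ^ (i + j) :: int)"
  shows "alternating_sum C B D (n - 1) f \<cdot> alternating_sum C A B n g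
    = finprod (hom_group C A D) F {(i, j). 1 \<le> i \<and> i < j \<and> j \<le> n}
      +\<^sub>m finprod (hom_group C A D) F {(i, j). 1 \<le> j \<and> j \<le> i \<and> i < n}"
proof -
  interpret G: comm_group "hom_group C A D" using objs hom_comm_group by blast
  have fg: "f i \<cdot> g j \<in> Hom C A D" if "1 \<le> i" "i < n" "1 \<le> j" "j \<le> n" for i j
    using comp_hom[OF g f] that by simp
  have F_hom: "F (i, j) \<in> Hom C A D" if "1 \<le> i" "i < n" "1 \<le> j" "j \<le> n" for i j
    using smul_hom[OF fg[OF that]] smul_eq[OF fg[OF that]] by (simp add: F_def)
  have sign: "(- 1) ^ (i - 1) * (- 1) ^ (j - 1) = ((- 1) ^ (i + j) :: int)" if "1 \<le> i" "1 \<le> j" for i j :: nat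
    using that by (cases i; cases j) (simp_all add: power_add)
  have "alternating_sum C B D (n - 1) f \<cdot> alternating_sum C A B n g
      = alternating_sum C A D (n - 1) (\<lambda>i. f i \<cdot> alternating_sum C A B n g)"
    using objs f g by (intro comp_alternating_sum_left alternating_sum_hom) auto
  also have "\<dots> = msum C A D (\<lambda>i. msum C A D (\<lambda>j. F (i, j)) {1..n}) {1..n - 1}"
    unfolding alternating_sum_def[of C A D]
  proof (rule msum_cong)
    fix i assume "i \<in> {1..n - 1}"
    then have i: "1 \<le> i" "i < n" by auto
    have "f i \<cdot> alternating_sum C A B n g = alternating_sum C A D n (\<lambda>j. f i \<cdot> g j)"
      using objs f g i by (intro comp_alternating_sum_right) auto
    also have "smul C ((- 1) ^ (i - 1)) \<dots>
        = msum C A D (\<lambda>j. smul C ((- 1) ^ (i - 1)) (smul C ((- 1) ^ (j - 1)) (f i \<cdot> g j))) {1..n}"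
      unfolding alternating_sum_def using objs fg i by (intro smul_msum smul_hom) auto
    also have "\<dots> = msum C A D (\<lambda>j. F (i, j)) {1..n}"
    proof (rule msum_cong[OF objs(1,3)])
      fix j assume "j \<in> {1..n}"
      then have j: "1 \<le> j" "j \<le> n" by auto
      show "smul C ((- 1) ^ (i - 1)) (smul C ((- 1) ^ (j - 1)) (f i \<cdot> g j)) = F (i, j)"
        using smul_smul[OF fg[OF i j]] sign[OF i(1) j(1)] smul_eq[OF fg[OF i j]] by (simp add: F_def)
      show "F (i, j) \<in> Hom C A D" by (rule F_hom[OF i j])
    qed
    finally show "smul C ((- 1) ^ (i - 1)) (f i \<cdot> alternating_sum C A B n g)
        = msum C A D (\<lambda>j. F (i, j)) {1..n}" .
    show "msum C A D (\<lambda>j. F (i, j)) {1..n} \<in> Hom C A D"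
      using objs i by (intro msum_hom F_hom) auto
  qed (use objs in auto)
  also have "\<dots> = msum C A D F ({1..n - 1} \<times> {1..n})"
    using objs F_hom msum_Times[of A D "{1..n - 1}" "{1..n}" "\<lambda>i j. F (i, j)"] by fastforce
  also have "{1..n - 1} \<times> {1..n}
      = {(i, j). 1 \<le> i \<and> i < j \<and> j \<le> n} \<union> {(i, j). 1 \<le> j \<and> j \<le> i \<and> i < n}"
    using n by auto
  also have "msum C A D F \<dots> = finprod (hom_group C A D) F {(i, j). 1 \<le> i \<and> i < j \<and> j \<le> n}
      +\<^sub>m finprod (hom_group C A D) F {(i, j). 1 \<le> j \<and> j \<le> i \<and> i < n}"
  proof -
    have "finite {(i, j). 1 \<le> i \<and> i < j \<and> j \<le> n}"
      by (rule finite_subset[of _ "{..n} \<times> {..n}"]) auto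
    moreover have "finite {(i, j). 1 \<le> j \<and> j \<le> i \<and> i < n}"
      by (rule finite_subset[of _ "{..n} \<times> {..n}"]) auto
    ultimately show ?thesis
      unfolding msum_def
      by (intro G.finprod_Un_disjoint[unfolded hom_group_simps]) (auto intro!: F_hom)
  qed
  finally show ?thesis .
qed


section \<open>From simplicial identities to differentials and homotopies\<close>

text \<open>
  The lower triangle of each composite cancels against the upper triangle of the other one.
\<close>

lemma comp_alternating_sums_cancel:
  assumes objs: "A \<in> Obj C" "B \<in> Obj C" "D \<in> Obj C" and n: "1 \<le> n"
    and f: "\<And>i. \<lbrakk>1 \<le> i; i < n\<rbrakk> \<Longrightarrow> f i \<in> Hom C B D" "\<And>i. \<lbrakk>1 \<le> i; i < n\<rbrakk> \<Longrightarrow> f' i \<in> Hom C B D"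
    and g: "\<And>j. \<lbrakk>1 \<le> j; j \<le> n\<rbrakk> \<Longrightarrow> g j \<in> Hom C A B" "\<And>j. \<lbrakk>1 \<le> j; j \<le> n\<rbrakk> \<Longrightarrow> g' j \<in> Hom C A B"
    and eq: "\<And>i j. \<lbrakk>1 \<le> i; i < j; j \<le> n\<rbrakk> \<Longrightarrow> f i \<cdot> g j = f' (j - 1) \<cdot> g' i"
      "\<And>i j. \<lbrakk>1 \<le> i; i < j; j \<le> n\<rbrakk> \<Longrightarrow> f' i \<cdot> g' j = f (j - 1) \<cdot> g i"
  shows "(alternating_sum C B D (n - 1) f \<cdot> alternating_sum C A B n g)
    +\<^sub>m (alternating_sum C B D (n - 1) f' \<cdot> alternating_sum C A B n g') = mzero C A D"
proof -
  interpret G: comm_group "hom_group C A D" using objs hom_comm_group by blast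
  let ?lower = "{(i, j). 1 \<le> i \<and> i < j \<and> j \<le> n}" and ?upper = "{(i, j). 1 \<le> j \<and> j \<le> i \<and> i < n}"
  define F where "F = (\<lambda>(i, j). (f i \<cdot> g j) [^]\<^bsub>hom_group C A D\<^esub> ((- 1) ^ (i + j) :: int))"
  define F' where "F' = (\<lambda>(i, j). (f' i \<cdot> g' j) [^]\<^bsub>hom_group C A D\<^esub> ((- 1) ^ (i + j) :: int))"
  have fg: "f i \<cdot> g j \<in> Hom C A D" "f' i \<cdot> g' j \<in> Hom C A D"
    if "1 \<le> i" "i < n" "1 \<le> j" "j \<le> n" for i j
    using comp_hom[OF g(1) f(1)] comp_hom[OF g(2) f(2)] that by simp_all
  have closed: "finprod (hom_group C A D) H S \<in> Hom C A D"
    if "H \<in> {F, F'}" "S \<in> {?lower, ?upper}" for H S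
    using that fg G.int_pow_closed
    by (intro G.finprod_closed[unfolded hom_group_simps]) (auto simp: F_def F'_def)
  have 1: "finprod (hom_group C A D) F ?lower +\<^sub>m finprod (hom_group C A D) F' ?upper = mzero C A D"
    unfolding F_def F'_def
    by (rule G.alternating_pairs_cancel[unfolded hom_group_simps]) (rule eq(1) fg(1); simp)+
  have 2: "finprod (hom_group C A D) F' ?lower +\<^sub>m finprod (hom_group C A D) F ?upper = mzero C A D"
    unfolding F_def F'_def
    by (rule G.alternating_pairs_cancel[unfolded hom_group_simps]) (rule eq(2) fg(2); simp)+
  let ?sum = "finprod (hom_group C A D)"
  have swap: "(a +\<^sub>m b) +\<^sub>m (a' +\<^sub>m b') = (a +\<^sub>m b') +\<^sub>m (a' +\<^sub>m b)"
    if "a \<in> Hom C A D" "b \<in> Hom C A D" "a' \<in> Hom C A D" "b' \<in> Hom C A D" for a b a' b'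
    using that G.m_ac[unfolded hom_group_simps] G.m_closed[unfolded hom_group_simps] by metis
  have "alternating_sum C B D (n - 1) f \<cdot> alternating_sum C A B n g = ?sum F ?lower +\<^sub>m ?sum F ?upper"
    unfolding F_def by (rule comp_alternating_sums[OF objs n f(1) g(1)])
  moreover have "alternating_sum C B D (n - 1) f' \<cdot> alternating_sum C A B n g'
      = ?sum F' ?lower +\<^sub>m ?sum F' ?upper"
    unfolding F'_def by (rule comp_alternating_sums[OF objs n f(2) g(2)])
  moreover have "(?sum F ?lower +\<^sub>m ?sum F ?upper) +\<^sub>m (?sum F' ?lower +\<^sub>m ?sum F' ?upper)
      = (?sum F ?lower +\<^sub>m ?sum F' ?upper) +\<^sub>m (?sum F' ?lower +\<^sub>m ?sum F ?upper)"
    by (rule swap; rule closed; simp)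
  moreover have "mzero C A D +\<^sub>m mzero C A D = mzero C A D"
    using G.l_one G.one_closed by simp
  ultimately show ?thesis by (simp only: 1 2)
qed

text \<open>
  Here the two triangles of one and the same composite cancel. This does not follow from
  \<open>comp_alternating_sums_cancel\<close> with equal families, which would only say that twice the
  composite is zero.
\<close>

lemma presimplicial_differential:
  assumes d: "presimplicial C X d"
    and D: "\<And>n. 1 \<le> n \<Longrightarrow> D n = alternating_sum C (X n) (X (n - 1)) n (d n)"
  shows "differential C X D"
  unfolding differential_def
proof (intro conjI allI impI)
  have X: "X n \<in> Obj C" for n using d by (simp add: presimplicial_def)
  have hom: "d n i \<in> Hom C (X n) (X (n - 1))" if "1 \<le> i" "i \<le> n" for n i
    using d that by (simp add: presimplicial_def)
  fix n :: nat
  {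
    assume "n > 0"
    then show "D n \<in> Hom C (X n) (X (n - 1))"
      using D[of n] alternating_sum_hom[OF X X hom] by simp
  }
  assume n: "n > 1"
  interpret G: comm_group "hom_group C (X n) (X (n - 2))" using X hom_comm_group by blast
  let ?lower = "{(i, j). 1 \<le> i \<and> i < j \<and> j \<le> n}" and ?upper = "{(i, j). 1 \<le> j \<and> j \<le> i \<and> i < n}"
  \<comment> \<open>the target of the second face is \<open>X (n - 1 - 1)\<close>, while a composite of differentials ends in \<open>X (n - 2)\<close>\<close>
  have n2: "n - 1 - 1 = n - 2" by simp
  have hom': "d (n - 1) i \<in> Hom C (X (n - 1)) (X (n - 2))" if "1 \<le> i" "i < n" for i
    using hom[of i "n - 1"] that unfolding n2 by simp
  have eq: "d (n - 1) i \<cdot> d n j = d (n - 1) (j - 1) \<cdot> d n i" if "1 \<le> i" "i < j" "j \<le> n" for i j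
    using d that by (simp add: presimplicial_def)
  have "D (n - 1) \<cdot> D n = alternating_sum C (X (n - 1)) (X (n - 2)) (n - 1) (d (n - 1))
      \<cdot> alternating_sum C (X n) (X (n - 1)) n (d n)"
    using D[of n] D[of "n - 1"] n unfolding n2 by simp
  also have "\<dots> = mzero C (X n) (X (n - 2))"
  proof (subst comp_alternating_sums[OF X X X])
    show "finprod (hom_group C (X n) (X (n - 2)))
          (\<lambda>(i, j). (d (n - 1) i \<cdot> d n j) [^]\<^bsub>hom_group C (X n) (X (n - 2))\<^esub> ((- 1) ^ (i + j) :: int)) ?lower
        +\<^sub>m finprod (hom_group C (X n) (X (n - 2)))
          (\<lambda>(i, j). (d (n - 1) i \<cdot> d n j) [^]\<^bsub>hom_group C (X n) (X (n - 2))\<^esub> ((- 1) ^ (i + j) :: int)) ?upper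
      = mzero C (X n) (X (n - 2))"
      by (rule G.alternating_pairs_cancel[unfolded hom_group_simps])
        (rule eq comp_hom[OF hom hom']; simp)+
  qed (use n hom hom' in auto)
  finally show "D (n - 1) \<cdot> D n = mzero C (X n) (X (n - 2))" .
qed

lemma pre_bisimplicial_anticommute:
  assumes d: "pre_bisimplicial C X d d'"
    and D: "\<And>n. 1 \<le> n \<Longrightarrow> D n = alternating_sum C (X n) (X (n - 1)) n (d n)"
    and D': "\<And>n. 1 \<le> n \<Longrightarrow> D' n = alternating_sum C (X n) (X (n - 1)) n (d' n)"
    and n: "n > 1"
  shows "(D' (n - 1) \<cdot> D n) +\<^sub>m (D (n - 1) \<cdot> D' n) = mzero C (X n) (X (n - 2))"
proof -
  have X: "X n \<in> Obj C" for n using d by (simp add: pre_bisimplicial_def presimplicial_def)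
  have hom: "d n i \<in> Hom C (X n) (X (n - 1))" "d' n i \<in> Hom C (X n) (X (n - 1))"
    if "1 \<le> i" "i \<le> n" for n i
    using d that by (simp_all add: pre_bisimplicial_def presimplicial_def)
  have n2: "n - 1 - 1 = n - 2" by simp
  have hom': "d (n - 1) i \<in> Hom C (X (n - 1)) (X (n - 2))" "d' (n - 1) i \<in> Hom C (X (n - 1)) (X (n - 2))"
    if "1 \<le> i" "i < n" for i
    using hom[of i "n - 1"] that unfolding n2 by simp_all
  have eq: "d' (n - 1) i \<cdot> d n j = d (n - 1) (j - 1) \<cdot> d' n i"
    "d (n - 1) i \<cdot> d' n j = d' (n - 1) (j - 1) \<cdot> d n i" if "1 \<le> i" "i < j" "j \<le> n" for i j
    using d that by (simp_all add: pre_bisimplicial_def)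
  have "(alternating_sum C (X (n - 1)) (X (n - 2)) (n - 1) (d' (n - 1))
        \<cdot> alternating_sum C (X n) (X (n - 1)) n (d n))
      +\<^sub>m (alternating_sum C (X (n - 1)) (X (n - 2)) (n - 1) (d (n - 1))
        \<cdot> alternating_sum C (X n) (X (n - 1)) n (d' n)) = mzero C (X n) (X (n - 2))"
    using n by (intro comp_alternating_sums_cancel X hom hom' eq) auto
  then show ?thesis
    using D[of n] D[of "n - 1"] D'[of n] D'[of "n - 1"] n unfolding n2 by simp
qed

text \<open>
  Sliding \<open>e\<close> past the first \<open>n\<close> faces turns \<open>D\<^sub>n\<^sub>+\<^sub>1 \<circ> e\<^sub>n\<close> into \<open>e\<^sub>n\<^sub>-\<^sub>1 \<circ> D\<^sub>n\<close> plus the term of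
  the last face, which is \<open>(- 1)\<^sup>n Id\<close>. The signs of the homotopy make the two occurrences of
  \<open>e\<^sub>n\<^sub>-\<^sub>1 \<circ> D\<^sub>n\<close> cancel and the identity survive.
\<close>

lemma extra_degeneracy_contracting:
  assumes d: "presimplicial C X d"
    and D: "\<And>n. 1 \<le> n \<Longrightarrow> D n = alternating_sum C (X n) (X (n - 1)) n (d n)"
    and e: "\<And>n. e n \<in> Hom C (X n) (X (n + 1))"
    and slide: "\<And>n i. \<lbrakk>1 \<le> i; i \<le> n\<rbrakk> \<Longrightarrow> d (n + 1) i \<cdot> e n = e (n - 1) \<cdot> d n i"
    and retract: "\<And>n. 1 \<le> n \<Longrightarrow> d (n + 1) (n + 1) \<cdot> e n = Id C (X n)"
  shows "contracting_homotopy C X D (\<lambda>n. smul C ((- 1) ^ n) (e n))"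
  unfolding contracting_homotopy_def
proof (intro conjI allI impI)
  show "differential C X D" by (rule presimplicial_differential[OF d D])
  show "smul C ((- 1) ^ n) (e n) \<in> Hom C (X n) (X (n + 1))" for n by (rule smul_hom[OF e])
  have X: "X n \<in> Obj C" for n using d by (simp add: presimplicial_def)
  have hom: "d n i \<in> Hom C (X n) (X (n - 1))" if "1 \<le> i" "i \<le> n" for n i
    using d that by (simp add: presimplicial_def)
  fix n :: nat assume "n > 0"
  then obtain m where m: "n = Suc m" by (cases n) auto
  interpret G: comm_group "hom_group C (X n) (X n)" using X hom_comm_group by blast
  let ?k = "(- 1) ^ m :: int"
  have e': "e m \<in> Hom C (X m) (X n)" using e[of m] m by simp
  have ed: "e m \<cdot> d n i \<in> Hom C (X n) (X n)" if "1 \<le> i" "i \<le> n" for i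
    using comp_hom[OF _ e', of "d n i" "X n"] hom[of i n] that m by simp
  \<comment> \<open>\<open>E\<close> is the common part \<open>e\<^sub>n\<^sub>-\<^sub>1 \<circ> D\<^sub>n\<close> of the two terms\<close>
  define E where "E = alternating_sum C (X n) (X n) n (\<lambda>i. e m \<cdot> d n i)"
  have E: "E \<in> Hom C (X n) (X n)" unfolding E_def using X ed by (intro alternating_sum_hom) auto
  have d_hom: "d n i \<in> Hom C (X n) (X m)" if "1 \<le> i" "i \<le> n" for i
    using hom[of i n] that m by simp
  have Dn: "D n = alternating_sum C (X n) (X m) n (d n)"
    using D[of n] m by simp
  have Dn_hom: "D n \<in> Hom C (X n) (X m)"
    unfolding Dn by (intro alternating_sum_hom X d_hom)
  have "e m \<cdot> D n = E"
    unfolding Dn E_def by (intro comp_alternating_sum_right[OF e' X] d_hom)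
  then have first: "smul C ?k (e m) \<cdot> D n = smul C ?k E"
    using comp_smul_left[OF Dn_hom e'] by simp
  have hom_Suc: "d (Suc n) i \<in> Hom C (X (Suc n)) (X n)" if "1 \<le> i" "i \<le> Suc n" for i
    using hom[of i "Suc n"] that by simp
  have en: "e n \<in> Hom C (X n) (X (Suc n))" using e[of n] by simp
  have DSn: "D (Suc n) = alternating_sum C (X (Suc n)) (X n) (Suc n) (d (Suc n))"
    using D[of "Suc n"] by simp
  have DSn_hom: "D (Suc n) \<in> Hom C (X (Suc n)) (X n)"
    unfolding DSn by (intro alternating_sum_hom X hom_Suc)
  have "D (Suc n) \<cdot> e n = alternating_sum C (X n) (X n) (Suc n) (\<lambda>i. d (Suc n) i \<cdot> e n)"
    unfolding DSn using hom_Suc by (intro comp_alternating_sum_left[OF en X]) auto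
  also have "\<dots> = smul C ((- 1) ^ n) (d (Suc n) (Suc n) \<cdot> e n)
      +\<^sub>m alternating_sum C (X n) (X n) n (\<lambda>i. d (Suc n) i \<cdot> e n)"
    using comp_hom[OF en hom_Suc] by (intro alternating_sum_Suc X)
  also have "d (Suc n) (Suc n) \<cdot> e n = Id C (X n)"
    using retract[of n] m by simp
  also have "alternating_sum C (X n) (X n) n (\<lambda>i. d (Suc n) i \<cdot> e n) = E"
    unfolding E_def using slide[of _ n] m ed X by (intro alternating_sum_cong) auto
  finally have second: "D (Suc n) \<cdot> e n = smul C ((- 1) ^ n) (Id C (X n)) +\<^sub>m E" .
  have Idn: "Id C (X n) \<in> Hom C (X n) (X n)" using X Id_hom by blast
  have "D (Suc n) \<cdot> smul C ((- 1) ^ n) (e n) = smul C ((- 1) ^ n) (smul C ((- 1) ^ n) (Id C (X n)) +\<^sub>m E)"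
    using comp_smul_right[OF DSn_hom en] second by simp
  also have "\<dots> = smul C ((- 1) ^ n) (smul C ((- 1) ^ n) (Id C (X n))) +\<^sub>m smul C ((- 1) ^ n) E"
    using smul_add[OF smul_hom[OF Idn] E] .
  also have "smul C ((- 1) ^ n) (smul C ((- 1) ^ n) (Id C (X n))) = Id C (X n)"
    using smul_smul[OF Idn] smul_one[OF Idn] by (simp flip: power_add power_mult_distrib)
  finally have total: "(smul C ?k (e m) \<cdot> D n) +\<^sub>m (D (Suc n) \<cdot> smul C ((- 1) ^ n) (e n))
      = smul C ?k E +\<^sub>m (Id C (X n) +\<^sub>m smul C (- ?k) E)"
    using first m by simp
  have kE: "smul C (- ?k) E = m_inv (hom_group C (X n) (X n)) (smul C ?k E)"
    using G.int_pow_neg[of E ?k] E by (simp add: smul_eq)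
  have "smul C ?k E +\<^sub>m (Id C (X n) +\<^sub>m smul C (- ?k) E) = Id C (X n)"
    unfolding kE
    using Idn smul_hom[OF E, of ?k] G.inv_closed[of "smul C ?k E"]
      G.m_lcomm[of "smul C ?k E" "Id C (X n)" "m_inv (hom_group C (X n) (X n)) (smul C ?k E)"]
      G.r_inv[of "smul C ?k E"] G.r_one[of "Id C (X n)"] by simp
  with total m show "(smul C ((- 1) ^ (n - 1)) (e (n - 1)) \<cdot> D n)
      +\<^sub>m (D (n + 1) \<cdot> smul C ((- 1) ^ n) (e n)) = Id C (X n)" by simp
qed

end


section \<open>Morphisms on tensor powers\<close>

locale tensor_powers = preadditive_strict_monoidal_category C
  for C :: "('o, 'm, 'x) moncat_scheme" (structure) +
  fixes V :: 'o
  assumes V_Obj: "V \<in> Obj C"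
begin

abbreviation pow :: "nat \<Rightarrow> 'o" where "pow \<equiv> tpow C V"
declare tpow.simps [simp del]

lemma pow_Obj [simp]: "pow n \<in> Obj C"
  by (induction n) (simp_all add: tpow.simps unit_Obj V_Obj tens_Obj)

lemma pow_0: "pow 0 = unit_obj C"
  and pow_1: "pow 1 = V"
  and pow_Suc_0: "pow (Suc 0) = V"
  and pow_2: "pow 2 = V \<otimes>\<^sub>o V"
  by (simp_all add: tpow.simps numeral_2_eq_2 tens_obj_unit_right V_Obj)

lemma pow_add: "pow m \<otimes>\<^sub>o pow n = pow (m + n)"
  by (induction m) (simp_all add: tpow.simps tens_obj_unit_left tens_obj_assoc V_Obj)

lemma Id_pow_hom [simp]: "Id C (pow n) \<in> Hom C (pow n) (pow n)"
  by (simp add: Id_hom)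

lemma Id_pow_Arr [simp]: "Id C (pow n) \<in> Arr C"
  using Hom_Arr[OF Id_pow_hom] .

lemma Id_pow_tens: "Id C (pow m) \<otimes>\<^sub>m Id C (pow n) = Id C (pow (m + n))"
  by (simp add: tens_Id pow_add)

lemma Id_pow_tens_assoc:
  assumes "f \<in> Arr C"
  shows "Id C (pow m) \<otimes>\<^sub>m (Id C (pow n) \<otimes>\<^sub>m f) = Id C (pow (m + n)) \<otimes>\<^sub>m f"
  using assms tens_mor_assoc[of "Id C (pow m)" "Id C (pow n)" f] by (simp add: Id_pow_tens)

lemma tens_pow_hom:
  assumes "f \<in> Hom C (pow k) (pow l)" "g \<in> Hom C (pow m) (pow n)"
  shows "f \<otimes>\<^sub>m g \<in> Hom C (pow (k + m)) (pow (l + n))"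
  using tens_hom[OF assms] by (simp add: pow_add)

text \<open>
  The form of \<open>ext\<close> that names the numbers of identity strands on both sides. Calculations are
  done with it, since these numbers just add up, and then translated back to positions.
\<close>

abbreviation pad :: "nat \<Rightarrow> 'm \<Rightarrow> nat \<Rightarrow> 'm" where
  "pad a f b \<equiv> Id C (pow a) \<otimes>\<^sub>m f \<otimes>\<^sub>m Id C (pow b)"

lemma pad_hom:
  assumes "f \<in> Hom C (pow l) (pow r)"
  shows "pad a f b \<in> Hom C (pow (a + l + b)) (pow (a + r + b))"
  using tens_pow_hom[OF Id_pow_hom tens_pow_hom[OF assms Id_pow_hom]] by (simp add: add.assoc)

lemma pad_comp:
  assumes "f \<in> Hom C (pow l) (pow r)" "g \<in> Hom C (pow r) (pow t)"
  shows "pad a g b \<cdot> pad a f b = pad a (g \<cdot> f) b"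
proof -
  have "(g \<cdot> f) \<otimes>\<^sub>m Id C (pow b) = (g \<otimes>\<^sub>m Id C (pow b)) \<cdot> (f \<otimes>\<^sub>m Id C (pow b))"
    using interchange[OF assms Id_pow_hom Id_pow_hom] comp_Id_left[OF Id_pow_hom] by simp
  then show ?thesis
    using interchange[OF Id_pow_hom Id_pow_hom tens_pow_hom[OF assms(1) Id_pow_hom]
        tens_pow_hom[OF assms(2) Id_pow_hom]] comp_Id_left[OF Id_pow_hom] by simp
qed

lemma pad_pad:
  assumes "f \<in> Arr C" "f \<otimes>\<^sub>m Id C (pow d) \<in> Arr C"
  shows "pad a (pad c f d) b = pad (a + c) f (d + b)"
proof -
  have "(Id C (pow c) \<otimes>\<^sub>m (f \<otimes>\<^sub>m Id C (pow d))) \<otimes>\<^sub>m Id C (pow b)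
      = Id C (pow c) \<otimes>\<^sub>m (f \<otimes>\<^sub>m Id C (pow (d + b)))"
    using assms by (simp add: tens_mor_assoc Id_pow_tens)
  moreover have "f \<otimes>\<^sub>m Id C (pow (d + b)) \<in> Arr C"
    using assms tens_mor_assoc[of f "Id C (pow d)" "Id C (pow b)"]
      tens_hom[of "f \<otimes>\<^sub>m Id C (pow d)" _ _ "Id C (pow b)", OF _ Id_pow_hom]
    by (auto simp: Id_pow_tens Hom_def)
  ultimately show ?thesis by (simp add: Id_pow_tens_assoc)
qed

lemma pad_exchange:
  assumes f: "f \<in> Hom C (pow l) (pow r)" and g: "g \<in> Hom C (pow l') (pow r')"
  shows "pad a f (c + r' + b) \<cdot> pad (a + l + c) g b = pad (a + r + c) g b \<cdot> pad a f (c + l' + b)"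
proof -
  have f1: "Id C (pow a) \<otimes>\<^sub>m f \<in> Hom C (pow (a + l)) (pow (a + r))"
    using tens_pow_hom[OF Id_pow_hom f] .
  have g1: "pad c g b \<in> Hom C (pow (c + l' + b)) (pow (c + r' + b))"
    using pad_hom[OF g] .
  have fm: "pad a f m = (Id C (pow a) \<otimes>\<^sub>m f) \<otimes>\<^sub>m Id C (pow m)" for m
    using Hom_Arr[OF f] by (simp add: tens_mor_assoc)
  have gm: "pad (m + c) g b = Id C (pow m) \<otimes>\<^sub>m pad c g b" for m
    using Hom_Arr[OF tens_pow_hom[OF g Id_pow_hom]] by (simp add: Id_pow_tens_assoc)
  show ?thesis
    unfolding fm gm using tens_comp_whisker[OF f1 g1] by simp
qed

lemma ext_eq_pad: "ext C V l (a + l + b) (Suc a) f = pad a f b"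
  by (simp add: ext_def)

lemma ext_hom:
  assumes "f \<in> Hom C (pow l) (pow r)" "1 \<le> i" "i + l \<le> Suc n" "m = n - l + r"
  shows "ext C V l n i f \<in> Hom C (pow n) (pow m)"
proof -
  obtain a where a: "i = Suc a" using assms(2) by (cases i) auto
  then obtain b where b: "n = a + l + b" using assms(3) le_Suc_ex by auto
  show ?thesis
    using pad_hom[OF assms(1), of a b] assms(4) unfolding a b ext_eq_pad by (simp add: ac_simps)
qed

lemma ext_comp:
  assumes "f \<in> Hom C (pow l) (pow r)" "g \<in> Hom C (pow r) (pow t)" "1 \<le> i" "i + l \<le> Suc n"
    "m = n - l + r"
  shows "ext C V r m i g \<cdot> ext C V l n i f = ext C V l n i (g \<cdot> f)"
proof -
  obtain a where a: "i = Suc a" using assms(3) by (cases i) auto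
  then obtain b where b: "n = a + l + b" using assms(4) le_Suc_ex by auto
  have m: "m = a + r + b" using assms(5) b by simp
  show ?thesis
    unfolding a b m ext_eq_pad by (rule pad_comp[OF assms(1,2)])
qed

text \<open>
  A relation that holds on a few strands is transported with this lemma and \<open>ext_comp\<close> to any
  position among \<open>n\<close> strands.
\<close>

lemma ext_ext:
  assumes "f \<in> Hom C (pow l) (pow r)" "1 \<le> i" "i + l \<le> Suc m" "1 \<le> j" "j + m \<le> Suc n"
    "k = j + i - 1"
  shows "ext C V m n j (ext C V l m i f) = ext C V l n k f"
proof -
  obtain a where a: "j = Suc a" using assms(4) by (cases j) auto
  obtain c where c: "i = Suc c" using assms(2) by (cases i) auto
  then obtain d where d: "m = c + l + d" using assms(3) le_Suc_ex by auto
  obtain b where b: "n = a + m + b" using assms(5) a le_Suc_ex by auto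
  have "k = Suc (a + c)" "n = (a + c) + l + (d + b)"
    using assms(6) a c b d by simp_all
  then show ?thesis
    using pad_pad[OF Hom_Arr[OF assms(1)] Hom_Arr[OF tens_pow_hom[OF assms(1) Id_pow_hom]], of a c d b]
      ext_eq_pad[of l c d f] ext_eq_pad[of m a b "pad c f d"] ext_eq_pad[of l "a + c" "d + b" f] a c d b
    by (simp add: add.assoc)
qed

text \<open>
  Morphisms on disjoint groups of strands commute. Acting first on the left group shifts the
  position of the right one by the change in the number of strands, from \<open>j\<close> to \<open>j - l + r\<close>.
\<close>

lemma ext_exchange:
  assumes f: "f \<in> Hom C (pow l) (pow r)" and g: "g \<in> Hom C (pow l') (pow r')"
    and "1 \<le> i" "i + l \<le> j" "j + l' \<le> Suc n" "m = n - l' + r'" "k = n - l + r" "j' = j - l + r"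
  shows "ext C V l m i f \<cdot> ext C V l' n j g = ext C V l' k j' g \<cdot> ext C V l n i f"
proof -
  obtain a where a: "i = Suc a" using assms(3) by (cases i) auto
  then obtain c where c: "j = Suc (a + l + c)"
    using assms(4) le_Suc_ex[of "Suc (a + l)" j] by auto
  then obtain b where b: "n = a + l + c + l' + b"
    using assms(5) le_Suc_ex[of "a + l + c + l'" n] by auto
  have "m = a + l + (c + r' + b)" "k = a + r + c + l' + b" "j' = Suc (a + r + c)"
    "n = a + l + (c + l' + b)"
    using assms(6-8) a b c by simp_all
  then show ?thesis
    using pad_exchange[OF f g, of a c b] ext_eq_pad[of l a "c + r' + b" f]
      ext_eq_pad[of l' "a + l + c" b g] ext_eq_pad[of l' "a + r + c" b g]
      ext_eq_pad[of l a "c + l' + b" f] a b c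
    by (simp only:)
qed

lemma ext_smul:
  assumes \<beta>: "\<beta> \<in> Hom C (pow l) (pow r)" and "1 \<le> i" "i + l \<le> Suc n"
  shows "ext C V l n i (smul C k \<beta>) = smul C k (ext C V l n i \<beta>)"
proof (rule additive_map(1)[OF _ _ _ _ _ _ \<beta>])
  show "ext C V l n i f \<in> Hom C (pow n) (pow (n - l + r))" if "f \<in> Hom C (pow l) (pow r)" for f
    using ext_hom[OF that] assms by simp
  show "ext C V l n i (f +\<^sub>m g) = ext C V l n i f +\<^sub>m ext C V l n i g"
    if f: "f \<in> Hom C (pow l) (pow r)" and g: "g \<in> Hom C (pow l) (pow r)" for f g
    unfolding ext_def tens_add_left[OF f g Id_pow_hom]
    by (rule tens_add_right[OF Id_pow_hom tens_pow_hom[OF f Id_pow_hom] tens_pow_hom[OF g Id_pow_hom]])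
qed simp_all

text \<open>
  Once one of two neighbouring strands is evaluated, the other one takes its place; so the order
  of evaluation does not matter, and both composites are the character \<open>\<chi> \<otimes> \<chi>\<close> on the pair.
\<close>

lemma adjacent_characters:
  assumes \<chi>: "\<chi> \<in> Hom C (pow 1) (pow 0)" and "1 \<le> i" "i < n"
  shows "ext C V 1 (n - 1) i \<chi> \<cdot> ext C V 1 n i \<chi> = ext C V 2 n i (\<chi> \<otimes>\<^sub>m \<chi>)"
    and "ext C V 1 (n - 1) i \<chi> \<cdot> ext C V 1 n (Suc i) \<chi> = ext C V 2 n i (\<chi> \<otimes>\<^sub>m \<chi>)"
proof -
  have \<chi>1: "ext C V 1 2 1 \<chi> \<in> Hom C (pow 2) (pow 1)"
    by (rule ext_hom[OF \<chi>]) auto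
  have "ext C V 1 1 1 \<chi> = \<chi>" "ext C V 1 2 1 \<chi> = \<chi> \<otimes>\<^sub>m Id C (pow 1)"
    using \<chi> Hom_Arr[OF tens_hom[OF \<chi> Id_pow_hom[of 1]]]
    by (simp_all add: ext_def pow_0 tens_mor_unit_left tens_mor_unit_right Hom_Arr)
  then have "ext C V 1 1 1 \<chi> \<cdot> ext C V 1 2 1 \<chi> = \<chi> \<otimes>\<^sub>m \<chi>"
    using tens_comp_whisker(2)[OF \<chi> \<chi>] Hom_Arr[OF \<chi>]
    by (simp add: pow_0 tens_mor_unit_left)
  moreover have "ext C V 1 n i \<chi> = ext C V 2 n i (ext C V 1 2 1 \<chi>)"
    using assms by (intro ext_ext[OF \<chi>, symmetric]) auto
  moreover have "ext C V 1 (n - 1) i \<chi> \<cdot> ext C V 2 n i (ext C V 1 2 1 \<chi>)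
      = ext C V 2 n i (\<chi> \<cdot> ext C V 1 2 1 \<chi>)"
    using assms by (intro ext_comp[OF \<chi>1 \<chi>]) auto
  ultimately show *: "ext C V 1 (n - 1) i \<chi> \<cdot> ext C V 1 n i \<chi> = ext C V 2 n i (\<chi> \<otimes>\<^sub>m \<chi>)"
    using \<open>ext C V 1 1 1 \<chi> = \<chi>\<close> by simp
  have "ext C V 1 (n - 1) i \<chi> \<cdot> ext C V 1 n (Suc i) \<chi> = ext C V 1 (n - 1) i \<chi> \<cdot> ext C V 1 n i \<chi>"
    using assms by (intro ext_exchange[OF \<chi> \<chi>]) auto
  with * show "ext C V 1 (n - 1) i \<chi> \<cdot> ext C V 1 n (Suc i) \<chi> = ext C V 2 n i (\<chi> \<otimes>\<^sub>m \<chi>)"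
    by simp
qed

end


section \<open>Braid words\<close>

lemma (in tensor_powers) crossing_hom:
  assumes "\<beta> \<in> Hom C (pow 2) (pow 2)" "1 \<le> i" "i < n"
  shows "ext C V 2 n i \<beta> \<in> Hom C (pow n) (pow n)"
  using assms by (intro ext_hom[OF assms(1)]) auto

locale prebraided_powers = tensor_powers C V
  for C :: "('o, 'm, 'x) moncat_scheme" (structure) and V :: 'o +
  fixes \<sigma> :: 'm
  assumes prebraided: "prebraided_object C V \<sigma>"
begin

abbreviation br :: "nat \<Rightarrow> nat \<Rightarrow> 'm" where "br n i \<equiv> ext C V 2 n i \<sigma>"

lemma sigma_hom: "\<sigma> \<in> Hom C (pow 2) (pow 2)"
  using prebraided by (simp add: prebraided_object_def pow_2)

lemma br_hom: "\<lbrakk>1 \<le> i; i < n\<rbrakk> \<Longrightarrow> br n i \<in> Hom C (pow n) (pow n)"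
  by (rule crossing_hom[OF sigma_hom])

lemma br_typing [simp]:
  assumes "1 \<le> i" "i < n"
  shows "br n i \<in> Arr C" "dom C (br n i) = pow n" "cod C (br n i) = pow n"
  using br_hom[OF assms] by (simp_all add: Hom_def)

lemma br_commute:
  assumes "1 \<le> i" "i + 1 < j" "j < n"
  shows "br n i \<cdot> br n j = br n j \<cdot> br n i"
  using assms by (intro ext_exchange[OF sigma_hom sigma_hom]) simp_all

lemma br_braid:
  assumes "1 \<le> i" "Suc i < n"
  shows "br n i \<cdot> (br n (Suc i) \<cdot> br n i) = br n (Suc i) \<cdot> (br n i \<cdot> br n (Suc i))"
proof -
  have lift: "ext C V 3 n i (br 3 k) = br n (i + k - 1)" if "1 \<le> k" "k < 3" for k
    using assms that by (intro ext_ext[OF sigma_hom]) auto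
  have h: "br 3 k \<in> Hom C (pow 3) (pow 3)" if "1 \<le> k" "k < 3" for k
    using that by (rule br_hom)
  have lift3: "ext C V 3 n i (br 3 k \<cdot> (br 3 l \<cdot> br 3 m))
      = br n (i + k - 1) \<cdot> (br n (i + l - 1) \<cdot> br n (i + m - 1))"
    if "1 \<le> k" "k < 3" "1 \<le> l" "l < 3" "1 \<le> m" "m < 3" for k l m
    using that assms ext_comp[OF h[of m] h[of l], of i n n]
      ext_comp[OF comp_hom[OF h[of m] h[of l]] h[of k], of i n n] by (simp add: lift)
  from prebraided have "br 3 1 \<cdot> (br 3 2 \<cdot> br 3 1) = br 3 2 \<cdot> (br 3 1 \<cdot> br 3 2)"
    by (simp add: prebraided_object_def)
  then show ?thesis
    using lift3[of 1 2 1] lift3[of 2 1 2] by simp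
qed

end

text \<open>
  The morphism \<open>T_mor\<close> along a given word instead of a chosen shortest one.
\<close>

definition braid_word :: "('o, 'm, 'x) moncat_scheme \<Rightarrow> 'o \<Rightarrow> 'm \<Rightarrow> nat \<Rightarrow> nat list \<Rightarrow> 'm" where
  "braid_word C V \<beta> n w = foldr (\<lambda>i f. ext C V 2 n i \<beta> \<cdot>\<^bsub>C\<^esub> f) w (Id C (tpow C V n))"

lemma T_mor_move_left:
  "\<lbrakk>1 \<le> i; i \<le> n\<rbrakk> \<Longrightarrow> T_mor C V \<beta> n (move_left i) = braid_word C V \<beta> n [1..<i]"
  by (simp add: T_mor_def braid_word_def shortest_word_move_left del: One_nat_def)

lemma T_mor_move_right:
  "\<lbrakk>1 \<le> i; i \<le> n\<rbrakk> \<Longrightarrow> T_mor C V \<beta> n (move_right n i) = braid_word C V \<beta> n (rev [i..<n])"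
  by (simp add: T_mor_def braid_word_def shortest_word_move_right)

context tensor_powers
begin

lemma braid_word_hom:
  assumes \<beta>: "\<beta> \<in> Hom C (pow 2) (pow 2)" and "set w \<subseteq> {1..<n}"
  shows "braid_word C V \<beta> n w \<in> Hom C (pow n) (pow n)"
  using assms(2)
proof (induction w)
  case (Cons a w)
  have "ext C V 2 n a \<beta> \<in> Hom C (pow n) (pow n)"
    using crossing_hom[OF \<beta>, of a n] Cons.prems by simp
  then show ?case using Cons by (simp add: braid_word_def comp_hom)
qed (simp add: braid_word_def)

lemma braid_word_append_single:
  assumes \<beta>: "\<beta> \<in> Hom C (pow 2) (pow 2)" and "set w \<subseteq> {1..<n}" and b: "1 \<le> b" "b < n"
  shows "braid_word C V \<beta> n (w @ [b]) = braid_word C V \<beta> n w \<cdot> ext C V 2 n b \<beta>"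
  using assms(2)
proof (induction w)
  case Nil
  have "ext C V 2 n b \<beta> \<in> Hom C (pow n) (pow n)"
    using crossing_hom[OF \<beta>, of b n] b by simp
  then show ?case by (simp add: braid_word_def comp_Id_left comp_Id_right)
next
  case (Cons a w)
  have h: "ext C V 2 n k \<beta> \<in> Hom C (pow n) (pow n)" if "1 \<le> k" "k < n" for k
    using crossing_hom[OF \<beta>, of k n] that by simp
  have "braid_word C V \<beta> n w \<in> Hom C (pow n) (pow n)"
    using braid_word_hom[OF \<beta>] Cons.prems by simp
  then have "(ext C V 2 n a \<beta> \<cdot> braid_word C V \<beta> n w) \<cdot> ext C V 2 n b \<beta>
      = ext C V 2 n a \<beta> \<cdot> (braid_word C V \<beta> n w \<cdot> ext C V 2 n b \<beta>)"
    using Cons.prems b by (intro comp_assoc[OF h _ h]) auto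
  then show ?case using Cons by (simp add: braid_word_def)
qed

end


section \<open>Faces\<close>

locale two_characters = prebraided_powers C V \<sigma>
  for C :: "('o, 'm, 'x) moncat_scheme" (structure) and V :: 'o and \<sigma> :: 'm +
  fixes \<epsilon> \<zeta> :: 'm
  assumes left_character: "braided_character C V \<sigma> \<epsilon>"
    and right_character: "braided_character C V \<sigma> \<zeta>"
begin

abbreviation d :: "nat \<Rightarrow> nat \<Rightarrow> 'm" where "d \<equiv> left_face C V \<sigma> \<epsilon>"
abbreviation d' :: "nat \<Rightarrow> nat \<Rightarrow> 'm" where "d' \<equiv> right_face C V \<sigma> \<zeta>"

lemma character_hom:
  "\<epsilon> \<in> Hom C (pow 1) (pow 0)" "\<zeta> \<in> Hom C (pow 1) (pow 0)"
  using left_character right_character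
  by (simp_all add: braided_character_def pow_0 pow_1 pow_Suc_0)

lemma left_face_hom:
  assumes "1 \<le> i" "i \<le> n"
  shows "d n i \<in> Hom C (pow n) (pow (n - 1))"
proof -
  have "braid_word C V \<sigma> n [1..<i] \<in> Hom C (pow n) (pow n)"
    using assms by (intro braid_word_hom[OF sigma_hom]) auto
  then show ?thesis
    using assms comp_hom[OF _ ext_hom[OF character_hom(1), of 1 n "n - 1"]]
    by (simp add: left_face_def T_mor_move_left)
qed

lemma right_face_hom:
  assumes "1 \<le> i" "i \<le> n"
  shows "d' n i \<in> Hom C (pow n) (pow (n - 1))"
proof -
  have "braid_word C V \<sigma> n (rev [i..<n]) \<in> Hom C (pow n) (pow n)"
    using assms by (intro braid_word_hom[OF sigma_hom]) auto
  then show ?thesis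
    using assms comp_hom[OF _ ext_hom[OF character_hom(2), of n n "n - 1"]]
    by (simp add: right_face_def T_mor_move_right)
qed

lemma face_typing [simp]:
  assumes "1 \<le> i" "i \<le> n"
  shows "d n i \<in> Arr C" "dom C (d n i) = pow n" "cod C (d n i) = pow (n - 1)"
    "d' n i \<in> Arr C" "dom C (d' n i) = pow n" "cod C (d' n i) = pow (n - 1)"
  using left_face_hom[OF assms] right_face_hom[OF assms] by (simp_all add: Hom_def)

lemma left_face_first: "1 \<le> n \<Longrightarrow> d n 1 = ext C V 1 n 1 \<epsilon>"
  using ext_hom[OF character_hom(1), of 1 n "n - 1"] comp_Id_right
  by (simp add: left_face_def T_mor_move_left braid_word_def del: One_nat_def)

lemma left_face_Suc:
  assumes "1 \<le> i" "i < n"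
  shows "d n (Suc i) = d n i \<cdot> br n i"
proof -
  have "braid_word C V \<sigma> n ([1..<i] @ [i]) = braid_word C V \<sigma> n [1..<i] \<cdot> br n i"
    using assms by (intro braid_word_append_single[OF sigma_hom]) auto
  moreover have "braid_word C V \<sigma> n [1..<i] \<in> Hom C (pow n) (pow n)"
    using assms by (intro braid_word_hom[OF sigma_hom]) auto
  ultimately show ?thesis
    using assms ext_hom[OF character_hom(1), of 1 n "n - 1"] br_hom[OF assms]
    by (simp add: left_face_def T_mor_move_left comp_assoc)
qed

lemma right_face_last: "1 \<le> n \<Longrightarrow> d' n n = ext C V 1 n n \<zeta>"
  using ext_hom[OF character_hom(2), of n n "n - 1"] comp_Id_right
  by (simp add: right_face_def T_mor_move_right braid_word_def)

lemma right_face_Suc: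
  assumes "1 \<le> i" "i < n"
  shows "d' n i = d' n (Suc i) \<cdot> br n i"
proof -
  have "braid_word C V \<sigma> n (rev [Suc i..<n] @ [i]) = braid_word C V \<sigma> n (rev [Suc i..<n]) \<cdot> br n i"
    using assms by (intro braid_word_append_single[OF sigma_hom]) auto
  moreover have "rev [Suc i..<n] @ [i] = rev [i..<n]"
    using assms by (simp add: upt_conv_Cons)
  moreover have "braid_word C V \<sigma> n (rev [Suc i..<n]) \<in> Hom C (pow n) (pow n)"
    using assms by (intro braid_word_hom[OF sigma_hom]) auto
  ultimately show ?thesis
    using assms ext_hom[OF character_hom(2), of n n "n - 1"] br_hom[OF assms]
    by (simp add: right_face_def T_mor_move_right comp_assoc)
qed

text \<open>
  Locality of the left faces: only the first \<open>i\<close> strands are involved.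
\<close>

lemma left_face_eq_ext:
  assumes "1 \<le> i" "i \<le> n"
  shows "d n i = ext C V i n 1 (d i i)"
  using assms
proof (induction i arbitrary: n rule: dec_induct)
  case base
  have "ext C V 1 n 1 (ext C V 1 1 1 \<epsilon>) = ext C V 1 n 1 \<epsilon>"
    using base by (intro ext_ext[OF character_hom(1)]) auto
  then show ?case using base left_face_first[of 1] left_face_first[of n] by simp
next
  case (step i)
  have \<lambda>: "d i i \<in> Hom C (pow i) (pow (i - 1))"
    using step.hyps step.prems by (intro left_face_hom) auto
  have "d n (Suc i) = ext C V i n 1 (d i i) \<cdot> br n i"
    using step.IH[of n] step.hyps step.prems by (simp add: left_face_Suc)
  also have "ext C V i n 1 (d i i) = ext C V (Suc i) n 1 (ext C V i (Suc i) 1 (d i i))"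
    using step.hyps step.prems by (intro ext_ext[OF \<lambda>, symmetric]) auto
  also have "ext C V i (Suc i) 1 (d i i) = d (Suc i) i"
    using step.IH[of "Suc i"] by simp
  also have "br n i = ext C V (Suc i) n 1 (br (Suc i) i)"
    using step.hyps step.prems by (intro ext_ext[OF sigma_hom, symmetric]) auto
  also have "ext C V (Suc i) n 1 (d (Suc i) i) \<cdot> ext C V (Suc i) n 1 (br (Suc i) i)
      = ext C V (Suc i) n 1 (d (Suc i) i \<cdot> br (Suc i) i)"
    using step.hyps step.prems br_hom[of i "Suc i"] left_face_hom[of i "Suc i"] by (intro ext_comp) auto
  finally show ?case using step.hyps step.prems by (simp add: left_face_Suc)
qed

text \<open>
  Locality of the right faces. The induction is on the number \<open>n - i\<close> of strands to be crossed,
  because the recursion for right faces increases \<open>i\<close>.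
\<close>

lemma right_face_eq_ext:
  assumes "1 \<le> i" "i \<le> n"
  shows "d' n i = ext C V (n - i + 1) n i (d' (n - i + 1) 1)"
  using assms
proof (induction "n - i" arbitrary: n i)
  case 0
  then have [simp]: "i = n" by simp
  have "ext C V 1 n n (ext C V 1 1 1 \<zeta>) = ext C V 1 n n \<zeta>"
    using 0 by (intro ext_ext[OF character_hom(2)]) auto
  then show ?case using 0 right_face_last[of 1] right_face_last[of n] by simp
next
  case (Suc k)
  define \<rho> where "\<rho> = d' (Suc k) 1"
  have n: "n = i + Suc k" using Suc by simp
  have \<rho>: "\<rho> \<in> Hom C (pow (Suc k)) (pow k)"
    using right_face_hom[of 1 "Suc k"] by (simp add: \<rho>_def)
  have "d' n i = ext C V (Suc k) n (Suc i) \<rho> \<cdot> br n i"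
    using Suc(1)[of n "Suc i"] Suc.prems n by (simp add: right_face_Suc \<rho>_def)
  also have "ext C V (Suc k) n (Suc i) \<rho> = ext C V (k + 2) n i (ext C V (Suc k) (k + 2) 2 \<rho>)"
    using Suc.prems n by (intro ext_ext[OF \<rho>, symmetric]) auto
  also have "ext C V (Suc k) (k + 2) 2 \<rho> = d' (k + 2) 2"
    using Suc(1)[of "k + 2" 2] by (simp add: \<rho>_def)
  also have "br n i = ext C V (k + 2) n i (br (k + 2) 1)"
    using Suc.prems n by (intro ext_ext[OF sigma_hom, symmetric]) auto
  also have "ext C V (k + 2) n i (d' (k + 2) 2) \<cdot> ext C V (k + 2) n i (br (k + 2) 1)
      = ext C V (k + 2) n i (d' (k + 2) 2 \<cdot> br (k + 2) 1)"
    using Suc.prems n br_hom[of 1 "k + 2"] right_face_hom[of 2 "k + 2"]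
    by (intro ext_comp) auto
  finally show ?case
    using n right_face_Suc[of 1 "k + 2"] by (simp add: numeral_2_eq_2)
qed

text \<open>
  The position of \<open>g\<close> drops by one because the face deletes a strand to the left of it.
\<close>

lemma left_face_slide:
  assumes g: "g \<in> Hom C (pow l) (pow r)" and "1 \<le> i" "i < j" "j + l \<le> Suc n" "m = n - l + r"
  shows "d m i \<cdot> ext C V l n j g = ext C V l (n - 1) (j - 1) g \<cdot> d n i"
proof -
  have \<lambda>: "d i i \<in> Hom C (pow i) (pow (i - 1))" using assms by (intro left_face_hom) auto
  have "ext C V i m 1 (d i i) \<cdot> ext C V l n j g = ext C V l (n - 1) (j - 1) g \<cdot> ext C V i n 1 (d i i)"
    using assms by (intro ext_exchange[OF \<lambda> g]) auto
  then show ?thesis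
    using assms left_face_eq_ext[of i m] left_face_eq_ext[of i n] by auto
qed

lemma right_face_slide:
  assumes g: "g \<in> Hom C (pow l) (pow r)" and "1 \<le> i" "i + l \<le> j" "j \<le> n" "m = n - l + r" "k = j - l + r"
  shows "d' m k \<cdot> ext C V l n i g = ext C V l (n - 1) i g \<cdot> d' n j"
proof -
  define \<rho> where "\<rho> = d' (n - j + 1) 1"
  have \<rho>: "\<rho> \<in> Hom C (pow (n - j + 1)) (pow (n - j))"
    using right_face_hom[of 1 "n - j + 1"] by (simp add: \<rho>_def)
  have "ext C V l (n - 1) i g \<cdot> ext C V (n - j + 1) n j \<rho> = ext C V (n - j + 1) m k \<rho> \<cdot> ext C V l n i g"
    using assms by (intro ext_exchange[OF g \<rho>]) auto
  moreover have "m - k + 1 = n - j + 1" using assms by simp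
  ultimately show ?thesis
    using assms right_face_eq_ext[of j n] right_face_eq_ext[of k m]
    by (simp add: \<rho>_def)
qed

end

section \<open>Identities between faces\<close>

lemma (in prebraided_powers) character_pair_braid:
  assumes "braided_character C V \<sigma> \<chi>" "1 \<le> i" "i < n"
  shows "ext C V 2 n i (\<chi> \<otimes>\<^sub>m \<chi>) \<cdot> br n i = ext C V 2 n i (\<chi> \<otimes>\<^sub>m \<chi>)"
proof -
  have \<chi>: "\<chi> \<in> Hom C (pow 1) (pow 0)"
    using assms by (simp add: braided_character_def pow_0 pow_1 pow_Suc_0)
  have \<chi>2: "\<chi> \<otimes>\<^sub>m \<chi> \<in> Hom C (pow 2) (pow 0)"
    using tens_pow_hom[OF \<chi> \<chi>] by (simp add: numeral_2_eq_2)
  have "ext C V 2 n i (\<chi> \<otimes>\<^sub>m \<chi>) \<cdot> br n i = ext C V 2 n i ((\<chi> \<otimes>\<^sub>m \<chi>) \<cdot> \<sigma>)"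
    using assms by (intro ext_comp[OF sigma_hom \<chi>2]) auto
  then show ?thesis using assms by (simp add: braided_character_def)
qed

context two_characters
begin

lemma left_face_br:
  assumes "1 \<le> i" "i < j" "j < n"
  shows "d n i \<cdot> br n j = br (n - 1) (j - 1) \<cdot> d n i"
  using assms by (intro left_face_slide[OF sigma_hom]) auto

lemma right_face_br:
  assumes "1 \<le> i" "Suc i < j" "j \<le> n"
  shows "d' n j \<cdot> br n i = br (n - 1) i \<cdot> d' n j"
  using assms by (intro right_face_slide[OF sigma_hom]) auto

text \<open>
  Keeps \<open>n - 1\<close> from being rewritten to \<open>n - Suc 0\<close>, so that equations about faces on \<open>n - 1\<close>
  strands match.
\<close>

declare One_nat_def [simp del]

text \<open>
  For \<open>i = 1\<close> this is the character equation. In the induction step, both sides are written as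
  \<open>d\<^sub>i d\<^sub>i\<close> after a braid on the strands \<open>i\<close>, \<open>i + 1\<close>, \<open>i + 2\<close>; the braid relation brings \<open>\<sigma>\<^sub>i\<close> to
  the front, where the induction hypothesis absorbs it.
\<close>

lemma left_faces_adjacent:
  assumes "1 \<le> i" "i < n"
  shows "d (n - 1) i \<cdot> d n (Suc i) = d (n - 1) i \<cdot> d n i"
  using assms
proof (induction i rule: dec_induct)
  case base
  have n: "1 \<le> n - 1" using base by simp
  have dd: "d (n - 1) 1 \<cdot> d n 1 = ext C V 2 n 1 (\<epsilon> \<otimes>\<^sub>m \<epsilon>)"
    using base n adjacent_characters(1)[OF character_hom(1), of 1 n]
      left_face_first[of "n - 1"] left_face_first[of n] by simp
  have "d n (Suc 1) = d n 1 \<cdot> br n 1" using base by (intro left_face_Suc) auto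
  then have "d (n - 1) 1 \<cdot> d n (Suc 1) = (d (n - 1) 1 \<cdot> d n 1) \<cdot> br n 1"
    using base n by (simp add: seq_assoc)
  then show ?case
    using character_pair_braid[OF left_character, of 1 n] base by (simp only: dd)
next
  case (step i)
  have i: "1 \<le> i" "Suc i < n" "i < n - 1" using step by auto
  have slide: "br (n - 1) i \<cdot> d n i = d n i \<cdot> br n (Suc i)"
    using left_face_br[of i "Suc i" n] i by simp
  have IH: "d (n - 1) i \<cdot> (d n i \<cdot> br n i) = d (n - 1) i \<cdot> d n i"
    using step i by (simp add: left_face_Suc)
  have IH': "d (n - 1) i \<cdot> (d n i \<cdot> (br n i \<cdot> x)) = d (n - 1) i \<cdot> (d n i \<cdot> x)"
    if "x \<in> Hom C (pow n) (pow n)" for x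
    using arg_cong[OF IH, of "\<lambda>z. z \<cdot> x"] that i by (simp add: seq_assoc Hom_def)
  have x: "br n (Suc i) \<cdot> br n i \<in> Hom C (pow n) (pow n)"
    using i by (intro comp_hom[OF br_hom br_hom]) auto
  have "d (n - 1) (Suc i) \<cdot> d n (Suc (Suc i))
      = d (n - 1) i \<cdot> (br (n - 1) i \<cdot> (d n i \<cdot> (br n i \<cdot> br n (Suc i))))"
    using i by (simp add: left_face_Suc seq_assoc)
  also have "\<dots> = d (n - 1) i \<cdot> (d n i \<cdot> (br n (Suc i) \<cdot> (br n i \<cdot> br n (Suc i))))"
    using i by (simp add: comp_slide[OF slide])
  also have "\<dots> = d (n - 1) i \<cdot> (d n i \<cdot> (br n i \<cdot> (br n (Suc i) \<cdot> br n i)))"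
    using i by (simp add: br_braid)
  also have "\<dots> = d (n - 1) i \<cdot> (d n i \<cdot> (br n (Suc i) \<cdot> br n i))"
    by (rule IH'[OF x])
  also have "\<dots> = d (n - 1) i \<cdot> (br (n - 1) i \<cdot> (d n i \<cdot> br n i))"
    using i by (simp add: comp_slide[OF slide])
  also have "\<dots> = d (n - 1) (Suc i) \<cdot> d n (Suc i)"
    using i by (simp add: left_face_Suc seq_assoc)
  finally show ?case .
qed

text \<open>
  Raising \<open>j\<close> appends a crossing \<open>\<sigma>\<^sub>j\<close>, which slides through \<open>d\<^sub>n\<^sub>;\<^sub>i\<close> because it lies to the
  right of strand \<open>i\<close>.
\<close>

lemma left_faces:
  assumes "1 \<le> i" "i < j" "j \<le> n"
  shows "d (n - 1) i \<cdot> d n j = d (n - 1) (j - 1) \<cdot> d n i"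
  using Suc_leI[OF assms(2)] assms(3)
proof (induction j rule: dec_induct)
  case base
  then show ?case using assms left_faces_adjacent[of i n] by simp
next
  case (step j)
  then obtain k where k: "j = Suc k" "1 \<le> k" using assms(1) by (cases j) auto
  have j: "i < j" "j < n" "k < n - 1" "i \<le> k" using step k by auto
  have slide: "d n i \<cdot> br n j = br (n - 1) k \<cdot> d n i"
    using left_face_br[of i j n] assms(1) j k by simp
  have "d (n - 1) i \<cdot> d n (Suc j) = (d (n - 1) i \<cdot> d n j) \<cdot> br n j"
    using assms(1) j by (simp add: left_face_Suc seq_assoc)
  also have "\<dots> = (d (n - 1) k \<cdot> d n i) \<cdot> br n j"
    using step k by simp
  also have "\<dots> = d (n - 1) (Suc k) \<cdot> d n i"
    using assms(1) j k(2) by (simp add: left_face_Suc seq_assoc slide)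
  finally show ?case using k by simp
qed

text \<open>
  The mirror image of \<open>left_faces_adjacent\<close>: the induction starts at the right end, \<open>i = n - 1\<close>.
\<close>

lemma right_faces_adjacent:
  assumes "1 \<le> i" "i < n"
  shows "d' (n - 1) i \<cdot> d' n (Suc i) = d' (n - 1) i \<cdot> d' n i"
  using assms
proof (induction "n - i" arbitrary: i)
  case (Suc k)
  show ?case
  proof (cases "Suc i = n")
    case True
    then have i: "i = n - 1" by simp
    have dd: "d' (n - 1) i \<cdot> d' n (Suc i) = ext C V 2 n i (\<zeta> \<otimes>\<^sub>m \<zeta>)"
      using Suc.prems True adjacent_characters(2)[OF character_hom(2), of i n]
        right_face_last[of i] right_face_last[of n] i by simp
    have "d' (n - 1) i \<cdot> d' n i = (d' (n - 1) i \<cdot> d' n (Suc i)) \<cdot> br n i"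
      using Suc.prems i by (simp add: right_face_Suc seq_assoc)
    then show ?thesis
      using character_pair_braid[OF right_character, of i n] Suc.prems by (simp add: dd)
  next
    case False
    define j where "j = Suc i"
    have i: "1 \<le> i" "i < j" "j < n" "i < n - 1" "1 \<le> j" "j \<le> n - 1" using Suc.prems False by (auto simp: j_def)
    have rec: "d' n i = d' n j \<cdot> br n i" "d' n j = d' n (Suc j) \<cdot> br n j"
      "d' (n - 1) i = d' (n - 1) j \<cdot> br (n - 1) i"
      using i right_face_Suc[of i n] right_face_Suc[of j n] right_face_Suc[of i "n - 1"]
      by (simp_all add: j_def)
    have slide: "br (n - 1) i \<cdot> d' n (Suc j) = d' n (Suc j) \<cdot> br n i"
      using right_face_br[of i "Suc j" n] i by (simp add: j_def)
    have IH: "d' (n - 1) j \<cdot> d' n (Suc j) = d' (n - 1) j \<cdot> (d' n (Suc j) \<cdot> br n j)"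
      using Suc(1)[of j] Suc.prems Suc(2) i rec(2) by (simp add: j_def)
    have IH': "d' (n - 1) j \<cdot> (d' n (Suc j) \<cdot> x) = d' (n - 1) j \<cdot> (d' n (Suc j) \<cdot> (br n j \<cdot> x))"
      if "x \<in> Hom C (pow n) (pow n)" for x
      using arg_cong[OF IH, of "\<lambda>z. z \<cdot> x"] that i by (simp add: seq_assoc Hom_def)
    have x: "br n i \<cdot> br n j \<in> Hom C (pow n) (pow n)"
      using i by (intro comp_hom[OF br_hom br_hom]) auto
    have "d' (n - 1) i \<cdot> d' n j = d' (n - 1) j \<cdot> (br (n - 1) i \<cdot> (d' n (Suc j) \<cdot> br n j))"
      using i by (simp add: rec seq_assoc)
    also have "\<dots> = d' (n - 1) j \<cdot> (d' n (Suc j) \<cdot> (br n i \<cdot> br n j))"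
      using i by (simp add: comp_slide[OF slide])
    also have "\<dots> = d' (n - 1) j \<cdot> (d' n (Suc j) \<cdot> (br n j \<cdot> (br n i \<cdot> br n j)))"
      by (rule IH'[OF x])
    also have "br n j \<cdot> (br n i \<cdot> br n j) = br n i \<cdot> (br n j \<cdot> br n i)"
      using i br_braid[of i n] by (simp add: j_def)
    also have "d' (n - 1) j \<cdot> (d' n (Suc j) \<cdot> (br n i \<cdot> (br n j \<cdot> br n i)))
        = d' (n - 1) j \<cdot> (br (n - 1) i \<cdot> (d' n (Suc j) \<cdot> (br n j \<cdot> br n i)))"
      using i by (simp add: comp_slide[OF slide])
    also have "\<dots> = d' (n - 1) i \<cdot> d' n i"
      using i by (simp add: rec seq_assoc)
    finally show ?thesis by (simp add: j_def)
  qed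
qed simp

lemma right_faces:
  assumes "1 \<le> i" "i < j" "j \<le> n"
  shows "d' (n - 1) i \<cdot> d' n j = d' (n - 1) (j - 1) \<cdot> d' n i"
  using assms
proof (induction "j - i" arbitrary: i)
  case (Suc k)
  show ?case
  proof (cases "j = Suc i")
    case True
    then show ?thesis using Suc.prems right_faces_adjacent[of i n] by simp
  next
    case False
    then have i: "1 \<le> i" "Suc i < j" "i < n" "i < n - 1" "j \<le> n" "1 \<le> j - 1" "j - 1 \<le> n - 1"
      using Suc.prems by auto
    have slide: "br (n - 1) i \<cdot> d' n j = d' n j \<cdot> br n i"
      using right_face_br[of i j n] i by simp
    have IH: "d' (n - 1) (Suc i) \<cdot> d' n j = d' (n - 1) (j - 1) \<cdot> d' n (Suc i)"
      using Suc(1)[of "Suc i"] Suc(2) i by simp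
    have "d' (n - 1) i \<cdot> d' n j = (d' (n - 1) (Suc i) \<cdot> d' n j) \<cdot> br n i"
      using i by (simp add: right_face_Suc seq_assoc slide)
    also have "\<dots> = d' (n - 1) (j - 1) \<cdot> d' n i"
      using i unfolding IH by (simp add: right_face_Suc seq_assoc)
    finally show ?thesis .
  qed
qed simp

text \<open>
  The strand \<open>i\<close> moves left and the strand \<open>j\<close> moves right with \<open>i < j\<close>, so their paths are
  disjoint.
\<close>

lemma left_right_faces:
  assumes "1 \<le> i" "i < j" "j \<le> n"
  shows "d (n - 1) i \<cdot> d' n j = d' (n - 1) (j - 1) \<cdot> d n i"
proof -
  have \<rho>: "d' (n - j + 1) 1 \<in> Hom C (pow (n - j + 1)) (pow (n - j))"
    using right_face_hom[of 1 "n - j + 1"] by simp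
  have "d (n - 1) i \<cdot> ext C V (n - j + 1) n j (d' (n - j + 1) 1)
      = ext C V (n - j + 1) (n - 1) (j - 1) (d' (n - j + 1) 1) \<cdot> d n i"
    using assms by (intro left_face_slide[OF \<rho>]) auto
  moreover have "n - 1 - (j - 1) + 1 = n - j + 1" using assms by simp
  ultimately show ?thesis
    using assms right_face_eq_ext[of j n] right_face_eq_ext[of "j - 1" "n - 1"] by simp
qed

text \<open>
  A crossing may be pulled under the strand that travels across it. The only step that is not an
  exchange of distant crossings is the braid relation at \<open>j = i + 1\<close>.
\<close>

lemma right_face_natural:
  assumes "1 \<le> i" "i < j" "j < n"
  shows "d' n i \<cdot> br n j = br (n - 1) (j - 1) \<cdot> d' n i"
  using assms
proof (induction "j - i" arbitrary: i)
  case (Suc k)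
  show ?case
  proof (cases "j = Suc i")
    case True
    have i: "1 \<le> i" "i < n" "j < n" "i < n - 1" "1 \<le> j" using Suc.prems True by auto
    have rec: "d' n i = d' n (Suc j) \<cdot> (br n j \<cdot> br n i)"
      using i True by (simp add: right_face_Suc seq_assoc)
    have slide: "d' n (Suc j) \<cdot> br n i = br (n - 1) i \<cdot> d' n (Suc j)"
      using right_face_br[of i "Suc j" n] i True by simp
    have "d' n i \<cdot> br n j = d' n (Suc j) \<cdot> (br n j \<cdot> (br n i \<cdot> br n j))"
      using i by (simp add: rec seq_assoc)
    also have "br n j \<cdot> (br n i \<cdot> br n j) = br n i \<cdot> (br n j \<cdot> br n i)"
      using i True br_braid[of i n] by simp
    also have "d' n (Suc j) \<cdot> \<dots> = br (n - 1) i \<cdot> d' n i"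
      using i by (simp add: comp_slide[OF slide] rec)
    finally show ?thesis using True by simp
  next
    case False
    then have i: "1 \<le> i" "Suc i < j" "j < n" "1 \<le> j - 1" "j - 1 < n - 1" using Suc.prems by auto
    have IH: "d' n (Suc i) \<cdot> br n j = br (n - 1) (j - 1) \<cdot> d' n (Suc i)"
      using Suc(1)[of "Suc i"] Suc(2) i by simp
    have "d' n i \<cdot> br n j = d' n (Suc i) \<cdot> (br n j \<cdot> br n i)"
      using i by (simp add: right_face_Suc[of i n] seq_assoc br_commute[of i j n])
    also have "\<dots> = br (n - 1) (j - 1) \<cdot> d' n i"
      using i by (simp add: right_face_Suc[of i n] comp_slide[OF IH])
    finally show ?thesis .
  qed
qed simp

text \<open>
  Here the strand \<open>i\<close> going right and the strand \<open>j\<close> going left cross once. For \<open>j = i + 1\<close> this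
  crossing can be regarded as the last crossing of either face; for larger \<open>j\<close> the additional
  crossing is carried along by \<open>right_face_natural\<close>.
\<close>

lemma right_left_faces:
  assumes "1 \<le> i" "i < j" "j \<le> n"
  shows "d' (n - 1) i \<cdot> d n j = d (n - 1) (j - 1) \<cdot> d' n i"
  using Suc_leI[OF assms(2)] assms(3)
proof (induction j rule: dec_induct)
  case base
  have i: "1 \<le> i" "i < n" "i \<le> n - 1" using base assms by auto
  have cross: "d' (n - 1) i \<cdot> d n i = d (n - 1) i \<cdot> d' n (Suc i)"
    using left_right_faces[of i "Suc i" n] i by simp
  have "d' (n - 1) i \<cdot> d n (Suc i) = (d' (n - 1) i \<cdot> d n i) \<cdot> br n i"
    using i by (simp add: left_face_Suc seq_assoc)
  also have "\<dots> = d (n - 1) i \<cdot> d' n i"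
    using i unfolding cross by (simp add: right_face_Suc seq_assoc)
  finally show ?case by simp
next
  case (step j)
  then obtain k where k: "j = Suc k" "1 \<le> k" using assms(1) by (cases j) auto
  have j: "1 \<le> i" "i < j" "j < n" "k < n - 1" "i \<le> n - 1" using step k assms by auto
  have natural: "d' n i \<cdot> br n j = br (n - 1) k \<cdot> d' n i"
    using right_face_natural[of i j n] j k by simp
  have "d' (n - 1) i \<cdot> d n (Suc j) = (d' (n - 1) i \<cdot> d n j) \<cdot> br n j"
    using j by (simp add: left_face_Suc seq_assoc)
  also have "\<dots> = (d (n - 1) k \<cdot> d' n i) \<cdot> br n j"
    using step k by simp
  also have "\<dots> = d (n - 1) (Suc k) \<cdot> d' n i"
    using j k(2) by (simp add: left_face_Suc seq_assoc natural)
  finally show ?case using k by simp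
qed

lemma faces_pre_bisimplicial: "pre_bisimplicial C pow d d'"
  using left_faces right_faces left_right_faces right_left_faces left_face_hom right_face_hom
  by (auto simp: pre_bisimplicial_def presimplicial_def)

end


section \<open>Degeneracies\<close>

context two_characters
begin

context
  fixes \<Delta> :: 'm
  assumes semi: "semi_prebraided_coalgebra C V \<sigma> \<Delta>"
begin

abbreviation s :: "nat \<Rightarrow> nat \<Rightarrow> 'm" where "s n i \<equiv> ext C V 1 n i \<Delta>"

lemma comult_hom: "\<Delta> \<in> Hom C (pow 1) (pow 2)"
  using semi by (simp add: semi_prebraided_coalgebra_def coassociative_def pow_1 pow_2)

lemma degeneracy_hom:
  assumes "1 \<le> i" "i \<le> n"
  shows "s n i \<in> Hom C (pow n) (pow (n + 1))"
  using assms by (intro ext_hom[OF comult_hom]) auto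

lemma degeneracy_typing [simp]:
  assumes "1 \<le> i" "i \<le> n"
  shows "s n i \<in> Arr C" "dom C (s n i) = pow n" "cod C (s n i) = pow (n + 1)"
  using degeneracy_hom[OF assms] by (simp_all add: Hom_def)

text \<open>
  For \<open>i < j\<close> the two comultiplications act on different strands; for \<open>i = j\<close> this is
  coassociativity.
\<close>

lemma degeneracies:
  assumes "1 \<le> i" "i \<le> j" "j \<le> n"
  shows "s (n + 1) i \<cdot> s n j = s (n + 1) (j + 1) \<cdot> s n i"
proof (cases "i = j")
  case False
  then show ?thesis using assms by (intro ext_exchange[OF comult_hom comult_hom]) auto
next
  case True
  have h: "s 2 k \<in> Hom C (pow 2) (pow 3)" if "1 \<le> k" "k \<le> 2" for k
    using degeneracy_hom[OF that] by simp
  have two_step: "s (n + 1) (i + k - 1) \<cdot> s n i = ext C V 1 n i (s 2 k \<cdot> \<Delta>)"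
    if "1 \<le> k" "k \<le> 2" for k
  proof -
    have "s (n + 1) (i + k - 1) = ext C V 2 (n + 1) i (s 2 k)"
      using assms that True by (intro ext_ext[OF comult_hom, symmetric]) auto
    also have "\<dots> \<cdot> s n i = ext C V 1 n i (s 2 k \<cdot> \<Delta>)"
      using assms that True by (intro ext_comp[OF comult_hom h]) auto
    finally show ?thesis .
  qed
  have "s 2 1 = \<Delta> \<otimes>\<^sub>m Id C V" "s 2 2 = Id C V \<otimes>\<^sub>m \<Delta>"
    using Hom_Arr[OF comult_hom] Hom_Arr[OF tens_pow_hom[OF comult_hom Id_pow_hom[of 1]]]
    by (simp_all add: ext_def pow_0 pow_1 pow_Suc_0 tens_mor_unit_left tens_mor_unit_right)
  then have "s 2 1 \<cdot> \<Delta> = s 2 2 \<cdot> \<Delta>"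
    using semi by (simp add: semi_prebraided_coalgebra_def coassociative_def)
  then show ?thesis using two_step[of 1] two_step[of 2] True by (simp add: Suc_eq_plus1)
qed

text \<open>
  Together with \<open>degeneracy_after_crossing\<close> this lifts either axiom of a pre-braided coalgebra
  from two strands to all positions. The indices \<open>a\<close>, \<open>b\<close>, \<open>c\<close> make one statement serve for both
  axioms.
\<close>

lemma two_crossings_after_degeneracy:
  assumes "1 \<le> i" "i < n" "a \<in> {1, 2}" "b \<in> {1, 2}" "c \<in> {1, 2}"
  shows "ext C V 2 n i (br 3 a \<cdot> (br 3 b \<cdot> s 2 c))
    = br (n + 1) (i + a - 1) \<cdot> (br (n + 1) (i + b - 1) \<cdot> s n (i + c - 1))"
proof -
  have br3: "br 3 k \<in> Hom C (pow 3) (pow 3)" if "k \<in> {1, 2}" for k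
    using that by (intro br_hom) auto
  have s2: "s 2 c \<in> Hom C (pow 2) (pow 3)"
    using degeneracy_hom[of c 2] assms by auto
  have br: "br (n + 1) (i + k - 1) = ext C V 3 (n + 1) i (br 3 k)" if "k \<in> {1, 2}" for k
    using assms that by (intro ext_ext[OF sigma_hom, symmetric]) auto
  have s: "s n (i + c - 1) = ext C V 2 n i (s 2 c)"
    using assms by (intro ext_ext[OF comult_hom, symmetric]) auto
  have "br (n + 1) (i + b - 1) \<cdot> s n (i + c - 1) = ext C V 2 n i (br 3 b \<cdot> s 2 c)"
    unfolding br[OF assms(4)] s using assms by (intro ext_comp[OF s2 br3]) auto
  moreover have "ext C V 3 (n + 1) i (br 3 a) \<cdot> ext C V 2 n i (br 3 b \<cdot> s 2 c)
      = ext C V 2 n i (br 3 a \<cdot> (br 3 b \<cdot> s 2 c))"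
    using assms by (intro ext_comp[OF comp_hom[OF s2 br3] br3]) auto
  ultimately show ?thesis by (simp only: br[OF assms(3)])
qed

lemma degeneracy_after_crossing:
  assumes "1 \<le> i" "i < n" "c \<in> {1, 2}"
  shows "ext C V 2 n i (s 2 c \<cdot> \<sigma>) = s n (i + c - 1) \<cdot> br n i"
proof -
  have s2: "s 2 c \<in> Hom C (pow 2) (pow 3)"
    using degeneracy_hom[of c 2] assms by auto
  have s: "s n (i + c - 1) = ext C V 2 n i (s 2 c)"
    using assms by (intro ext_ext[OF comult_hom, symmetric]) auto
  show ?thesis
    unfolding s using assms by (intro ext_comp[OF sigma_hom s2, symmetric]) auto
qed

lemma strand_over_degeneracy:
  assumes "1 \<le> i" "i < n"
  shows "br (n + 1) i \<cdot> (br (n + 1) (Suc i) \<cdot> s n i) = s n (Suc i) \<cdot> br n i"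
proof -
  have "s 2 2 \<cdot> \<sigma> = br 3 1 \<cdot> (br 3 2 \<cdot> s 2 1)"
    using semi by (simp add: semi_prebraided_coalgebra_def)
  then show ?thesis
    using two_crossings_after_degeneracy[of i n 1 2 1] degeneracy_after_crossing[of i n 2] assms
    by simp
qed

lemma left_face_degeneracy_less:
  assumes "1 \<le> i" "i < j" "j \<le> n"
  shows "d (n + 1) i \<cdot> s n j = s (n - 1) (j - 1) \<cdot> d n i"
  using assms by (intro left_face_slide[OF comult_hom]) auto

text \<open>
  A strand that passes to the left over the two copies produced by \<open>\<Delta>\<close> may as well pass before the
  comultiplication. The first axiom of a pre-braided coalgebra says this for a strand directly to
  the right of the copies, and further strands are handled by the recursion.
\<close>

lemma left_face_degeneracy_greater:
  assumes "1 \<le> j" "j + 1 < i" "i \<le> n + 1"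
  shows "d (n + 1) i \<cdot> s n j = s (n - 1) j \<cdot> d n (i - 1)"
  using Suc_leI[OF assms(2)] assms(3)
proof (induction i rule: dec_induct)
  case base
  have j: "1 \<le> j" "j < n" "j \<le> n - 1" using assms(1) base by auto
  have slide: "d (n + 1) j \<cdot> s n (Suc j) = s (n - 1) j \<cdot> d n j"
    using left_face_degeneracy_less[of j "Suc j" n] j by simp
  have "d (n + 1) (Suc (Suc j)) \<cdot> s n j
      = d (n + 1) j \<cdot> (br (n + 1) j \<cdot> (br (n + 1) (Suc j) \<cdot> s n j))"
    using j left_face_Suc[of "Suc j" "n + 1"] left_face_Suc[of j "n + 1"] by (simp add: seq_assoc)
  also have "\<dots> = d (n + 1) j \<cdot> (s n (Suc j) \<cdot> br n j)"
    using j by (simp only: strand_over_degeneracy)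
  also have "\<dots> = s (n - 1) j \<cdot> d n (Suc j)"
    using j comp_slide[OF slide, of "br n j"] by (simp add: left_face_Suc)
  finally show ?case by (simp add: Suc_eq_plus1)
next
  case (step i)
  then obtain k where k: "i = Suc k" by (cases i) auto
  have j: "1 \<le> j" "j < n" "j \<le> n - 1" "j < k" "k < n" "i \<le> n" "1 \<le> k" "1 \<le> i"
    using assms(1) step.hyps step.prems k by auto
  have far: "br (n + 1) i \<cdot> s n j = s n j \<cdot> br n k"
    using j k by (intro ext_exchange[OF comult_hom sigma_hom, symmetric]) auto
  have IH: "d (n + 1) i \<cdot> s n j = s (n - 1) j \<cdot> d n k"
    using step.IH step.prems k by simp
  have "d (n + 1) (Suc i) \<cdot> s n j = d (n + 1) i \<cdot> (br (n + 1) i \<cdot> s n j)"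
    using j left_face_Suc[of i "n + 1"] by (simp add: seq_assoc)
  also have "\<dots> = s (n - 1) j \<cdot> (d n k \<cdot> br n k)"
    unfolding far using j comp_slide[OF IH, of "br n k"] by simp
  also have "d n k \<cdot> br n k = d n i"
    using j left_face_Suc[of k n] k by simp
  finally show ?case by simp
qed

lemma left_very_weakly_simplicial: "very_weakly_simplicial C pow d s"
  using faces_pre_bisimplicial degeneracy_hom degeneracies
    left_face_degeneracy_less left_face_degeneracy_greater
  by (auto simp: very_weakly_simplicial_def pre_bisimplicial_def simp del: add_Suc_right)

lemma right_face_degeneracy_greater:
  assumes "1 \<le> j" "j + 1 < i" "i \<le> n + 1"
  shows "d' (n + 1) i \<cdot> s n j = s (n - 1) j \<cdot> d' n (i - 1)"
  using assms by (intro right_face_slide[OF comult_hom]) auto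

text \<open>
  The counterpart for a strand travelling to the right, which is where the second axiom of a
  pre-braided coalgebra enters.
\<close>

lemma right_face_degeneracy_less:
  assumes full: "prebraided_coalgebra C V \<sigma> \<Delta>" and "1 \<le> i" "i < j" "j \<le> n"
  shows "d' (n + 1) i \<cdot> s n j = s (n - 1) (j - 1) \<cdot> d' n i"
  using assms(2-)
proof (induction "j - i" arbitrary: i)
  case (Suc k)
  show ?case
  proof (cases "j = Suc i")
    case True
    have i: "1 \<le> i" "i < n" "i \<le> n - 1" "j \<le> n" "1 \<le> j" using Suc.prems True by auto
    have "s 2 1 \<cdot> \<sigma> = br 3 2 \<cdot> (br 3 1 \<cdot> s 2 2)"
      using full by (simp add: prebraided_coalgebra_def)
    then have under: "br (n + 1) j \<cdot> (br (n + 1) i \<cdot> s n j) = s n i \<cdot> br n i"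
      using two_crossings_after_degeneracy[of i n 2 1 2] degeneracy_after_crossing[of i n 1] i True
      by simp
    have slide: "d' (n + 1) (Suc j) \<cdot> s n i = s (n - 1) i \<cdot> d' n j"
      using right_face_degeneracy_greater[of i "Suc j" n] i True by simp
    have "d' (n + 1) i \<cdot> s n j = d' (n + 1) (Suc j) \<cdot> (br (n + 1) j \<cdot> (br (n + 1) i \<cdot> s n j))"
      using i True right_face_Suc[of i "n + 1"] right_face_Suc[of j "n + 1"] by (simp add: seq_assoc)
    also have "\<dots> = s (n - 1) i \<cdot> (d' n j \<cdot> br n i)"
      unfolding under using i comp_slide[OF slide, of "br n i"] by simp
    also have "d' n j \<cdot> br n i = d' n i"
      using i True right_face_Suc[of i n] by simp
    finally show ?thesis using True by simp
  next
    case False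
    then have i: "1 \<le> i" "Suc i < j" "i < n" "j \<le> n" "1 \<le> j - 1" "j - 1 \<le> n - 1" "1 \<le> j"
      using Suc.prems by auto
    have far: "br (n + 1) i \<cdot> s n j = s n j \<cdot> br n i"
      using i by (intro ext_exchange[OF sigma_hom comult_hom]) auto
    have IH: "d' (n + 1) (Suc i) \<cdot> s n j = s (n - 1) (j - 1) \<cdot> d' n (Suc i)"
      using Suc(1)[of "Suc i"] Suc(2) i by simp
    have "d' (n + 1) i \<cdot> s n j = d' (n + 1) (Suc i) \<cdot> (br (n + 1) i \<cdot> s n j)"
      using i right_face_Suc[of i "n + 1"] by (simp add: seq_assoc)
    also have "\<dots> = s (n - 1) (j - 1) \<cdot> (d' n (Suc i) \<cdot> br n i)"
      unfolding far using i comp_slide[OF IH, of "br n i"] by simp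
    also have "d' n (Suc i) \<cdot> br n i = d' n i"
      using i right_face_Suc[of i n] by simp
    finally show ?thesis .
  qed
qed simp

lemma right_very_weakly_simplicial:
  assumes "prebraided_coalgebra C V \<sigma> \<Delta>"
  shows "very_weakly_simplicial C pow d' s"
  using faces_pre_bisimplicial degeneracy_hom degeneracies
    right_face_degeneracy_less[OF assms] right_face_degeneracy_greater
  by (auto simp: very_weakly_simplicial_def pre_bisimplicial_def simp del: add_Suc_right)

text \<open>
  The two faces differ by the crossing of the two copies, which cocommutativity absorbs.
\<close>

lemma faces_degeneracy_equal:
  assumes "cocommutative C \<sigma> \<Delta>" "1 \<le> i" "i \<le> n"
  shows "d (n + 1) i \<cdot> s n i = d (n + 1) (i + 1) \<cdot> s n i"
    and "d' (n + 1) i \<cdot> s n i = d' (n + 1) (i + 1) \<cdot> s n i"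
proof -
  have "br (n + 1) i \<cdot> s n i = ext C V 1 n i (\<sigma> \<cdot> \<Delta>)"
    using assms by (intro ext_comp[OF comult_hom sigma_hom]) auto
  then have absorb: "br (n + 1) i \<cdot> s n i = s n i"
    using assms by (simp add: cocommutative_def)
  have "d (n + 1) (i + 1) \<cdot> s n i = d (n + 1) i \<cdot> (br (n + 1) i \<cdot> s n i)"
    using assms left_face_Suc[of i "n + 1"] by (simp add: seq_assoc Suc_eq_plus1)
  then show "d (n + 1) i \<cdot> s n i = d (n + 1) (i + 1) \<cdot> s n i"
    by (simp only: absorb)
  have "d' (n + 1) i \<cdot> s n i = d' (n + 1) (i + 1) \<cdot> (br (n + 1) i \<cdot> s n i)"
    using assms right_face_Suc[of i "n + 1"] by (simp add: seq_assoc Suc_eq_plus1)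
  then show "d' (n + 1) i \<cdot> s n i = d' (n + 1) (i + 1) \<cdot> s n i"
    by (simp only: absorb)
qed

end

end


section \<open>The shuffle differentials as alternating sums of faces\<close>

context tensor_powers
begin

text \<open>
  Each crossing contributes one sign, so \<open>- \<sigma>\<close> produces the sign of the length of the word.
\<close>

lemma braid_word_mneg:
  assumes \<beta>: "\<beta> \<in> Hom C (pow 2) (pow 2)" and "set w \<subseteq> {1..<n}"
  shows "braid_word C V (mneg C \<beta>) n w = smul C ((- 1) ^ length w) (braid_word C V \<beta> n w)"
  using assms(2)
proof (induction w)
  case Nil
  show ?case using smul_one[OF Id_pow_hom] by (simp add: braid_word_def)
next
  case (Cons a w)
  then have a: "1 \<le> a" "a < n" and w: "set w \<subseteq> {1..<n}" by auto
  have "braid_word C V (mneg C \<beta>) n (a # w)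
      = smul C (- 1) (ext C V 2 n a \<beta>) \<cdot> smul C ((- 1) ^ length w) (braid_word C V \<beta> n w)"
    using Cons.IH[OF w] ext_smul[OF \<beta>, of a n "- 1"] a
    by (simp add: braid_word_def mneg_eq_smul[OF \<beta>])
  also have "\<dots> = smul C (- 1 * (- 1) ^ length w) (ext C V 2 n a \<beta> \<cdot> braid_word C V \<beta> n w)"
    by (rule comp_smul_smul[OF braid_word_hom[OF \<beta> w] crossing_hom[OF \<beta> a]])
  finally show ?case by (simp add: braid_word_def)
qed

lemma csh_left_eq:
  assumes \<beta>: "\<beta> \<in> Hom C (pow 2) (pow 2)" and n: "1 \<le> n"
  shows "csh C V (mneg C \<beta>) 1 (n - 1)
    = alternating_sum C (pow n) (pow n) n (\<lambda>i. braid_word C V \<beta> n [1..<i])"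
proof -
  have words: "set [1..<i] \<subseteq> {1..<n}" if "i \<in> {1..n}" for i using that by auto
  have summand: "T_mor C V (mneg C \<beta>) n (inv_into UNIV (inv_into UNIV (move_left i)))
      = smul C ((- 1) ^ (i - 1)) (braid_word C V \<beta> n [1..<i])" if i: "i \<in> {1..n}" for i
  proof -
    have "bij (move_left i)"
      using permutes_word_perm[OF words[OF i]] word_perm_descending[of i] i permutes_bij by auto
    then show ?thesis
      using i braid_word_mneg[OF \<beta> words[OF i]] by (simp add: inv_inv_eq T_mor_move_left)
  qed
  have "csh C V (mneg C \<beta>) 1 (n - 1) = msum C (pow n) (pow n)
      (\<lambda>s. T_mor C V (mneg C \<beta>) n (inv_into UNIV s)) ((\<lambda>i. inv_into UNIV (move_left i)) ` {1..n})"
    using n Sh_left_eq(1)[OF n] by (simp add: csh_def)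
  also have "\<dots> = msum C (pow n) (pow n)
      (\<lambda>i. T_mor C V (mneg C \<beta>) n (inv_into UNIV (inv_into UNIV (move_left i)))) {1..n}"
    using summand smul_hom[OF braid_word_hom[OF \<beta> words]]
    by (intro msum_reindex Sh_left_eq(2)[OF n]) auto
  also have "\<dots> = alternating_sum C (pow n) (pow n) n (\<lambda>i. braid_word C V \<beta> n [1..<i])"
    unfolding alternating_sum_def
    using summand smul_hom[OF braid_word_hom[OF \<beta> words]] by (intro msum_cong) auto
  finally show ?thesis .
qed

text \<open>
  The move of strand \<open>i\<close> to the right end has \<open>n - i\<close> crossings; the factor \<open>(- 1)\<^sup>n\<^sup>-\<^sup>1\<close> in front
  turns the sign \<open>(- 1)\<^sup>n\<^sup>-\<^sup>i\<close> into the sign \<open>(- 1)\<^sup>i\<^sup>-\<^sup>1\<close> of an alternating sum.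
\<close>

lemma csh_right_eq:
  assumes \<beta>: "\<beta> \<in> Hom C (pow 2) (pow 2)" and n: "1 \<le> n"
  shows "csh C V (mneg C \<beta>) (n - 1) 1
    = smul C ((- 1) ^ (n - 1)) (alternating_sum C (pow n) (pow n) n (\<lambda>i. braid_word C V \<beta> n (rev [i..<n])))"
proof -
  have words: "set (rev [i..<n]) \<subseteq> {1..<n}" if "i \<in> {1..n}" for i using that by auto
  have hom: "smul C k (braid_word C V \<beta> n (rev [i..<n])) \<in> Hom C (pow n) (pow n)"
    if "i \<in> {1..n}" for i k
    by (rule smul_hom[OF braid_word_hom[OF \<beta> words[OF that]]])
  have summand: "T_mor C V (mneg C \<beta>) n (inv_into UNIV (inv_into UNIV (move_right n i)))
      = smul C ((- 1) ^ (n - 1)) (smul C ((- 1) ^ (i - 1)) (braid_word C V \<beta> n (rev [i..<n])))"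
    if i: "i \<in> {1..n}" for i
  proof -
    have "bij (move_right n i)"
      using permutes_word_perm[OF words[OF i]] word_perm_ascending[of i n] i permutes_bij by auto
    then have "T_mor C V (mneg C \<beta>) n (inv_into UNIV (inv_into UNIV (move_right n i)))
        = smul C ((- 1) ^ (n - i)) (braid_word C V \<beta> n (rev [i..<n]))"
      using i braid_word_mneg[OF \<beta> words[OF i]] by (simp add: inv_inv_eq T_mor_move_right)
    moreover have "n - 1 = (n - i) + (i - 1)" using i by auto
    then have "(- 1) ^ (n - 1) * (- 1) ^ (i - 1) = ((- 1) ^ (n - i) :: int)"
      by (simp add: power_add mult.assoc flip: power_mult_distrib)
    ultimately show ?thesis
      using smul_smul[OF braid_word_hom[OF \<beta> words[OF i]]] by simp
  qed
  have "csh C V (mneg C \<beta>) (n - 1) 1 = msum C (pow n) (pow n)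
      (\<lambda>s. T_mor C V (mneg C \<beta>) n (inv_into UNIV s)) ((\<lambda>i. inv_into UNIV (move_right n i)) ` {1..n})"
    using n Sh_right_eq(1)[OF n] by (simp add: csh_def)
  also have "\<dots> = msum C (pow n) (pow n)
      (\<lambda>i. T_mor C V (mneg C \<beta>) n (inv_into UNIV (inv_into UNIV (move_right n i)))) {1..n}"
    using summand smul_hom[OF hom] by (intro msum_reindex Sh_right_eq(2)[OF n]) auto
  also have "\<dots> = msum C (pow n) (pow n)
      (\<lambda>i. smul C ((- 1) ^ (n - 1)) (smul C ((- 1) ^ (i - 1)) (braid_word C V \<beta> n (rev [i..<n])))) {1..n}"
    using summand smul_hom[OF hom] by (intro msum_cong) auto
  also have "\<dots> = smul C ((- 1) ^ (n - 1))
      (alternating_sum C (pow n) (pow n) n (\<lambda>i. braid_word C V \<beta> n (rev [i..<n])))"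
    unfolding alternating_sum_def using hom by (intro smul_msum[symmetric]) auto
  finally show ?thesis .
qed

end

context two_characters
begin

lemma left_d_eq:
  assumes n: "1 \<le> n"
  shows "left_d C V \<sigma> \<epsilon> n = alternating_sum C (pow n) (pow (n - 1)) n (d n)"
proof -
  have \<epsilon>: "ext C V 1 n 1 \<epsilon> \<in> Hom C (pow n) (pow (n - 1))"
    using n by (intro ext_hom[OF character_hom(1)]) auto
  have "left_d C V \<sigma> \<epsilon> n
      = alternating_sum C (pow n) (pow (n - 1)) n (\<lambda>i. ext C V 1 n 1 \<epsilon> \<cdot> braid_word C V \<sigma> n [1..<i])"
    unfolding left_d_def csh_left_eq[OF sigma_hom n]
    by (intro comp_alternating_sum_right[OF \<epsilon>] braid_word_hom[OF sigma_hom]) auto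
  also have "\<dots> = alternating_sum C (pow n) (pow (n - 1)) n (d n)"
    using left_face_hom by (intro alternating_sum_cong) (auto simp: left_face_def T_mor_move_left)
  finally show ?thesis .
qed

lemma right_d_eq:
  assumes n: "1 \<le> n"
  shows "right_d C V \<sigma> \<zeta> n = alternating_sum C (pow n) (pow (n - 1)) n (d' n)"
proof -
  let ?w = "\<lambda>i. braid_word C V \<sigma> n (rev [i..<n])"
  have \<zeta>: "ext C V 1 n n \<zeta> \<in> Hom C (pow n) (pow (n - 1))"
    using n by (intro ext_hom[OF character_hom(2)]) auto
  have w: "?w i \<in> Hom C (pow n) (pow n)" if "1 \<le> i" for i
    using that by (intro braid_word_hom[OF sigma_hom]) auto
  have sum: "alternating_sum C (pow n) (pow n) n ?w \<in> Hom C (pow n) (pow n)"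
    using w by (intro alternating_sum_hom) auto
  have sign: "(- 1) ^ k * (- 1) ^ k = (1 :: int)" for k :: nat
    by (simp flip: power_mult_distrib)
  have "right_d C V \<sigma> \<zeta> n = ext C V 1 n n \<zeta> \<cdot> alternating_sum C (pow n) (pow n) n ?w"
    unfolding right_d_def csh_right_eq[OF sigma_hom n] comp_smul_right[OF \<zeta> sum]
    using smul_smul[OF comp_hom[OF sum \<zeta>]] smul_one[OF comp_hom[OF sum \<zeta>]] by (simp add: sign)
  also have "\<dots> = alternating_sum C (pow n) (pow (n - 1)) n (\<lambda>i. ext C V 1 n n \<zeta> \<cdot> ?w i)"
    using w by (intro comp_alternating_sum_right[OF \<zeta>]) auto
  also have "\<dots> = alternating_sum C (pow n) (pow (n - 1)) n (d' n)"
    using right_face_hom by (intro alternating_sum_cong) (auto simp: right_face_def T_mor_move_right)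
  finally show ?thesis .
qed

section \<open>Contracting homotopies\<close>

context
  fixes \<eta> :: 'm
  assumes unit_hom: "\<eta> \<in> Hom C (unit_obj C) V"
begin

abbreviation unit_at :: "nat \<Rightarrow> nat \<Rightarrow> 'm" where "unit_at n i \<equiv> ext C V 0 n i \<eta>"

lemma eta_hom: "\<eta> \<in> Hom C (pow 0) (pow 1)"
  using unit_hom by (simp add: pow_0 pow_1 pow_Suc_0)

lemma unit_at_hom: "\<lbrakk>1 \<le> i; i \<le> n + 1\<rbrakk> \<Longrightarrow> unit_at n i \<in> Hom C (pow n) (pow (n + 1))"
  by (intro ext_hom[OF eta_hom]) auto

lemma unit_at_typing [simp]:
  assumes "1 \<le> i" "i \<le> n + 1"
  shows "unit_at n i \<in> Arr C" "dom C (unit_at n i) = pow n" "cod C (unit_at n i) = pow (n + 1)"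
  using unit_at_hom[OF assms] by (simp_all add: Hom_def)

lemma unit_at_last: "unit_at n (n + 1) = Id C (pow n) \<otimes>\<^sub>m \<eta>"
  using Hom_Arr[OF eta_hom] by (simp add: ext_def pow_0 tens_mor_unit_right)

lemma unit_at_one_strand:
  "unit_at 1 1 = \<eta> \<otimes>\<^sub>m Id C V" "unit_at 1 2 = Id C V \<otimes>\<^sub>m \<eta>"
  using Hom_Arr[OF eta_hom] Hom_Arr[OF tens_pow_hom[OF eta_hom Id_pow_hom[of 1]]]
  by (simp_all add: ext_def pow_0 pow_1 pow_Suc_0 tens_mor_unit_left tens_mor_unit_right)

lemma character_after_unit:
  assumes \<chi>: "\<chi> \<in> Hom C (pow 1) (pow 0)" and "normalized_pair C \<eta> \<chi>" "1 \<le> i" "i \<le> n + 1"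
  shows "ext C V 1 (n + 1) i \<chi> \<cdot> unit_at n i = Id C (pow n)"
proof -
  have "ext C V 1 (n + 1) i \<chi> \<cdot> unit_at n i = ext C V 0 n i (\<chi> \<cdot> \<eta>)"
    using assms by (intro ext_comp[OF eta_hom \<chi>]) auto
  then show ?thesis
    using assms by (simp add: normalized_pair_def ext_def tens_Id tens_obj_unit_left unit_Obj pow_add)
qed

text \<open>
  Reduces the interaction of \<open>\<sigma>\<close> with a strand created by \<open>\<eta>\<close> to a morphism on a single strand,
  which is where demi-naturality and right compatibility are stated.
\<close>

lemma two_strands_unit:
  assumes "1 \<le> i" "i \<le> n"
  shows "br (n + 1) i \<cdot> unit_at n (i + 1) = ext C V 1 n i (\<sigma> \<cdot> unit_at 1 2)"
proof -
  have u: "unit_at 1 2 \<in> Hom C (pow 1) (pow 2)"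
    using unit_at_hom[of 2 1] by (simp add: numeral_2_eq_2)
  have "unit_at n (i + 1) = ext C V 1 n i (unit_at 1 2)"
    using assms by (intro ext_ext[OF eta_hom, symmetric]) auto
  then show ?thesis
    using assms ext_comp[OF u sigma_hom, of i n "n + 1"] by simp
qed

text \<open>
  The homotopy creates a strand at the right end, out of reach of the first \<open>n\<close> left faces. The
  last face pulls the new strand to the left end, which by demi-naturality amounts to creating it
  there, and normalization removes it.
\<close>

lemma left_contracting_homotopy:
  assumes normalized: "normalized_pair C \<eta> \<epsilon>" and natural: "demi_natural C V \<sigma> \<eta>"
  shows "contracting_homotopy C pow (left_d C V \<sigma> \<epsilon>) (\<lambda>n. smul C ((- 1) ^ n) (Id C (pow n) \<otimes>\<^sub>m \<eta>))"
proof (rule extra_degeneracy_contracting[OF _ left_d_eq])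
  show "presimplicial C pow d"
    using faces_pre_bisimplicial by (simp add: pre_bisimplicial_def)
  show "Id C (pow n) \<otimes>\<^sub>m \<eta> \<in> Hom C (pow n) (pow (n + 1))" for n
    using unit_at_hom[of "n + 1" n] by (simp add: unit_at_last)
  show "d (n + 1) i \<cdot> (Id C (pow n) \<otimes>\<^sub>m \<eta>) = (Id C (pow (n - 1)) \<otimes>\<^sub>m \<eta>) \<cdot> d n i"
    if i: "1 \<le> i" "i \<le> n" for n i
  proof -
    have "d (n + 1) i \<cdot> unit_at n (n + 1) = unit_at (n - 1) (n + 1 - 1) \<cdot> d n i"
      using i by (intro left_face_slide[OF eta_hom]) auto
    moreover have "n + 1 - 1 = n - 1 + 1" using i by simp
    ultimately show ?thesis by (simp only: unit_at_last)
  qed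
  have absorb: "br (n + 1) i \<cdot> unit_at n (i + 1) = unit_at n i" if "1 \<le> i" "i \<le> n" for n i
  proof -
    have "\<sigma> \<cdot> unit_at 1 2 = unit_at 1 1"
      using natural by (simp add: demi_natural_def unit_at_one_strand)
    moreover have "ext C V 1 n i (unit_at 1 1) = unit_at n i"
      using that by (intro ext_ext[OF eta_hom]) auto
    ultimately show ?thesis using two_strands_unit[OF that] by simp
  qed
  have "d (n + 1) (k + 1) \<cdot> unit_at n (k + 1) = Id C (pow n)" if "k \<le> n" for n k
    using that
  proof (induction k)
    case 0
    then show ?case
      using left_face_first[of "n + 1"] character_after_unit[OF character_hom(1) normalized, of 1 n]
      by simp
  next
    case (Suc k)
    have "d (n + 1) (Suc (k + 1)) \<cdot> unit_at n (Suc k + 1)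
        = d (n + 1) (k + 1) \<cdot> (br (n + 1) (k + 1) \<cdot> unit_at n (Suc k + 1))"
      using Suc.prems left_face_Suc[of "k + 1" "n + 1"] by (simp add: seq_assoc)
    also have "br (n + 1) (k + 1) \<cdot> unit_at n (Suc k + 1) = unit_at n (k + 1)"
      using absorb[of "k + 1" n] Suc.prems by (simp add: Suc_eq_plus1)
    finally show ?case using Suc by (simp add: Suc_eq_plus1)
  qed
  then show "d (n + 1) (n + 1) \<cdot> (Id C (pow n) \<otimes>\<^sub>m \<eta>) = Id C (pow n)" for n
    using unit_at_last[of n] by (metis order_refl)
qed

text \<open>
  Here the last face meets the new strand without any crossing. Any other face sends its strand
  across the new one in its last crossing, and right compatibility replaces crossing and
  evaluation by an evaluation followed by the creation of a new strand.
\<close>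

lemma right_contracting_homotopy:
  assumes normalized: "normalized_pair C \<eta> \<zeta>" and compatible: "right_compatible C V \<sigma> \<eta> \<zeta>"
  shows "contracting_homotopy C pow (right_d C V \<sigma> \<zeta>) (\<lambda>n. smul C ((- 1) ^ n) (Id C (pow n) \<otimes>\<^sub>m \<eta>))"
proof (rule extra_degeneracy_contracting[OF _ right_d_eq])
  show "presimplicial C pow d'"
    using faces_pre_bisimplicial by (simp add: pre_bisimplicial_def)
  show "Id C (pow n) \<otimes>\<^sub>m \<eta> \<in> Hom C (pow n) (pow (n + 1))" for n
    using unit_at_hom[of "n + 1" n] by (simp add: unit_at_last)
  show "d' (n + 1) (n + 1) \<cdot> (Id C (pow n) \<otimes>\<^sub>m \<eta>) = Id C (pow n)" for n
    using right_face_last[of "n + 1"] character_after_unit[OF character_hom(2) normalized, of "n + 1" n]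
    by (simp add: unit_at_last)
  have slide: "d' (n + 1) i \<cdot> unit_at n (n + 1) = unit_at (n - 1) n \<cdot> d' n i"
    if "1 \<le> i" "i \<le> n" for n i
    using that
  proof (induction "n - i" arbitrary: i)
    case 0
    then have n: "i = n" "1 \<le> n" by simp_all
    have u: "unit_at 1 2 \<in> Hom C (pow 1) (pow 2)"
      using unit_at_hom[of 2 1] by (simp add: numeral_2_eq_2)
    have z: "ext C V 1 2 2 \<zeta> \<in> Hom C (pow 2) (pow 1)"
      by (intro ext_hom[OF character_hom(2)]) auto
    have "d' (n + 1) n = d' (n + 1) (n + 1) \<cdot> br (n + 1) n"
      using n right_face_Suc[of n "n + 1"] by (simp add: Suc_eq_plus1)
    then have "d' (n + 1) n \<cdot> unit_at n (n + 1) = d' (n + 1) (n + 1) \<cdot> (br (n + 1) n \<cdot> unit_at n (n + 1))"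
      using n by (simp add: seq_assoc)
    also have "\<dots> = ext C V 2 (n + 1) n (ext C V 1 2 2 \<zeta>) \<cdot> ext C V 1 n n (\<sigma> \<cdot> unit_at 1 2)"
    proof -
      have "ext C V 2 (n + 1) n (ext C V 1 2 2 \<zeta>) = ext C V 1 (n + 1) (n + 1) \<zeta>"
        using n by (intro ext_ext[OF character_hom(2)]) auto
      then show ?thesis
        using two_strands_unit[of n n] right_face_last[of "n + 1"] n by simp
    qed
    also have "\<dots> = ext C V 1 n n (ext C V 1 2 2 \<zeta> \<cdot> (\<sigma> \<cdot> unit_at 1 2))"
      using n by (intro ext_comp[OF comp_hom[OF u sigma_hom] z]) auto
    also have "ext C V 1 2 2 \<zeta> \<cdot> (\<sigma> \<cdot> unit_at 1 2) = \<eta> \<cdot> \<zeta>"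
    proof -
      have "ext C V 1 2 2 \<zeta> = Id C V \<otimes>\<^sub>m \<zeta>"
        using Hom_Arr[OF character_hom(2)]
        by (simp add: ext_def pow_0 pow_1 pow_Suc_0 tens_mor_unit_right)
      then show ?thesis
        using compatible by (simp add: right_compatible_def unit_at_one_strand)
    qed
    also have "ext C V 1 n n (\<eta> \<cdot> \<zeta>) = unit_at (n - 1) n \<cdot> ext C V 1 n n \<zeta>"
      using n by (intro ext_comp[OF character_hom(2) eta_hom, symmetric]) auto
    finally show ?case using n right_face_last[of n] by simp
  next
    case (Suc k)
    then have i: "1 \<le> i" "i < n" by auto
    have IH: "d' (n + 1) (Suc i) \<cdot> unit_at n (n + 1) = unit_at (n - 1) n \<cdot> d' n (Suc i)"
      using Suc(1)[of "Suc i"] Suc(2) i by simp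
    have far: "br (n + 1) i \<cdot> unit_at n (n + 1) = unit_at n (n + 1) \<cdot> br n i"
      using i by (intro ext_exchange[OF sigma_hom eta_hom]) auto
    have "d' (n + 1) i \<cdot> unit_at n (n + 1) = d' (n + 1) (Suc i) \<cdot> (br (n + 1) i \<cdot> unit_at n (n + 1))"
      using i right_face_Suc[of i "n + 1"] by (simp add: seq_assoc)
    also have "\<dots> = unit_at (n - 1) n \<cdot> (d' n (Suc i) \<cdot> br n i)"
      unfolding far using i comp_slide[OF IH, of "br n i"] by simp
    also have "d' n (Suc i) \<cdot> br n i = d' n i"
      using i right_face_Suc[of i n] by simp
    finally show ?case .
  qed
  show "d' (n + 1) i \<cdot> (Id C (pow n) \<otimes>\<^sub>m \<eta>) = (Id C (pow (n - 1)) \<otimes>\<^sub>m \<eta>) \<cdot> d' n i"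
    if i: "1 \<le> i" "i \<le> n" for n i
  proof -
    have "n = n - 1 + 1" using i by simp
    then have "unit_at (n - 1) n = Id C (pow (n - 1)) \<otimes>\<^sub>m \<eta>"
      using unit_at_last[of "n - 1"] by simp
    then show ?thesis using slide[OF i] by (simp only: unit_at_last)
  qed
qed

end

end

theorem theorem5:
  fixes C :: "('o, 'm, 'x) moncat_scheme" and V :: 'o and \<sigma> \<epsilon> \<zeta> :: 'm
  assumes "preadditive_strict_monoidal_category C"
    and "prebraided_object C V \<sigma>"
    and "braided_character C V \<sigma> \<epsilon>"
    and "braided_character C V \<sigma> \<zeta>"
  shows
    "tensor_bidifferential C V (left_d C V \<sigma> \<epsilon>) (right_d C V \<sigma> \<zeta>)
     \<and>
     (pre_bisimplicial C (tpow C V) (left_face C V \<sigma> \<epsilon>) (right_face C V \<sigma> \<zeta>) \<and>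
      (\<forall>n\<ge>1. left_d C V \<sigma> \<epsilon> n =
          msum C (tpow C V n) (tpow C V (n - 1))
            (\<lambda>i. smul C ((-1) ^ (i - 1)) (left_face C V \<sigma> \<epsilon> n i)) {1..n}) \<and>
      (\<forall>n\<ge>1. right_d C V \<sigma> \<zeta> n =
          msum C (tpow C V n) (tpow C V (n - 1))
            (\<lambda>i. smul C ((-1) ^ (i - 1)) (right_face C V \<sigma> \<zeta> n i)) {1..n}))
     \<and>
     (\<forall>\<Delta>. prebraided_coalgebra C V \<sigma> \<Delta> \<longrightarrow>
        very_weakly_bisimplicial C (tpow C V) (left_face C V \<sigma> \<epsilon>) (right_face C V \<sigma> \<zeta>)
          (\<lambda>n i. ext C V 1 n i \<Delta>))
     \<and>
     (\<forall>\<Delta>. semi_prebraided_coalgebra C V \<sigma> \<Delta> \<longrightarrow>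
        very_weakly_simplicial C (tpow C V) (left_face C V \<sigma> \<epsilon>) (\<lambda>n i. ext C V 1 n i \<Delta>))
     \<and>
     ((\<forall>\<Delta>. prebraided_coalgebra C V \<sigma> \<Delta> \<and> cocommutative C \<sigma> \<Delta> \<longrightarrow>
        weakly_bisimplicial C (tpow C V) (left_face C V \<sigma> \<epsilon>) (right_face C V \<sigma> \<zeta>)
          (\<lambda>n i. ext C V 1 n i \<Delta>)) \<and>
      (\<forall>\<Delta>. semi_prebraided_coalgebra C V \<sigma> \<Delta> \<and> cocommutative C \<sigma> \<Delta> \<longrightarrow>
        weakly_simplicial C (tpow C V) (left_face C V \<sigma> \<epsilon>) (\<lambda>n i. ext C V 1 n i \<Delta>)))
     \<and>
     (\<forall>\<eta> \<in> Hom C (unit_obj C) V.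
        (normalized_pair C \<eta> \<epsilon> \<and> demi_natural C V \<sigma> \<eta> \<longrightarrow>
          contracting_homotopy C (tpow C V) (left_d C V \<sigma> \<epsilon>)
            (\<lambda>n. smul C ((-1) ^ n) (Id C (tpow C V n) \<otimes>\<^sub>m\<^bsub>C\<^esub> \<eta>))) \<and>
        (normalized_pair C \<eta> \<zeta> \<and> right_compatible C V \<sigma> \<eta> \<zeta> \<longrightarrow>
          contracting_homotopy C (tpow C V) (right_d C V \<sigma> \<zeta>)
            (\<lambda>n. smul C ((-1) ^ n) (Id C (tpow C V n) \<otimes>\<^sub>m\<^bsub>C\<^esub> \<eta>))))"
proof -
  interpret preadditive_strict_monoidal_category C by (rule assms(1))
  interpret two_characters C V \<sigma> \<epsilon> \<zeta>
    using assms(2-4) by unfold_locales (auto simp: prebraided_object_def)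
  have presimplicial: "presimplicial C pow d" "presimplicial C pow d'"
    using faces_pre_bisimplicial by (simp_all add: pre_bisimplicial_def)
  have bidifferential: "tensor_bidifferential C V (left_d C V \<sigma> \<epsilon>) (right_d C V \<sigma> \<zeta>)"
    unfolding tensor_bidifferential_def
    using presimplicial_differential[OF presimplicial(1) left_d_eq]
      presimplicial_differential[OF presimplicial(2) right_d_eq]
      pre_bisimplicial_anticommute[OF faces_pre_bisimplicial left_d_eq right_d_eq]
    by blast
  have refinement: "\<forall>n\<ge>1. left_d C V \<sigma> \<epsilon> n =
        msum C (pow n) (pow (n - 1)) (\<lambda>i. smul C ((- 1) ^ (i - 1)) (d n i)) {1..n}"
      "\<forall>n\<ge>1. right_d C V \<sigma> \<zeta> n =
        msum C (pow n) (pow (n - 1)) (\<lambda>i. smul C ((- 1) ^ (i - 1)) (d' n i)) {1..n}"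
    using left_d_eq right_d_eq by (simp_all add: alternating_sum_def)
  have very_weak: "very_weakly_simplicial C pow d (\<lambda>n i. ext C V 1 n i \<Delta>)"
    if "semi_prebraided_coalgebra C V \<sigma> \<Delta>" for \<Delta>
    by (rule left_very_weakly_simplicial[OF that])
  have semi: "semi_prebraided_coalgebra C V \<sigma> \<Delta>" if "prebraided_coalgebra C V \<sigma> \<Delta>" for \<Delta>
    using that by (simp add: prebraided_coalgebra_def)
  have very_weak': "very_weakly_simplicial C pow d' (\<lambda>n i. ext C V 1 n i \<Delta>)"
    if "prebraided_coalgebra C V \<sigma> \<Delta>" for \<Delta>
    by (rule right_very_weakly_simplicial[OF semi[OF that] that])
  have weak: "weakly_simplicial C pow d (\<lambda>n i. ext C V 1 n i \<Delta>)"
    if "semi_prebraided_coalgebra C V \<sigma> \<Delta>" "cocommutative C \<sigma> \<Delta>" for \<Delta>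
    using very_weak[OF that(1)] faces_degeneracy_equal(1)[OF that]
    by (simp only: weakly_simplicial_def) blast
  have weak': "weakly_simplicial C pow d' (\<lambda>n i. ext C V 1 n i \<Delta>)"
    if "prebraided_coalgebra C V \<sigma> \<Delta>" "cocommutative C \<sigma> \<Delta>" for \<Delta>
    using very_weak'[OF that(1)] faces_degeneracy_equal(2)[OF semi[OF that(1)] that(2)]
    by (simp only: weakly_simplicial_def) blast
  show ?thesis
    unfolding very_weakly_bisimplicial_def weakly_bisimplicial_def
    using bidifferential faces_pre_bisimplicial refinement very_weak very_weak' weak weak' semi
      left_contracting_homotopy right_contracting_homotopy
    by (intro conjI allI impI ballI) auto
qed

end
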